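(* Consider the discrete memoryless wiretap channel with causal state information at the encoder and the legitimate decoder and secure rate-limited feedback at rate $R_f$ (as defined in the context). Then the secrecy capacity satisfies \[ C_S\le \max_{p(x|s)}\min\{I(X;Y|Z,S)+H(S|Z)+R_f,\ I(X;Y|S)\}, \] where the joint distribution is $p(s)p(x|s)p(y,z|x,s)$.
   Context: Model: finite alphabets $\mathcal X,\mathcal Y,\mathcal Z,\mathcal S$. A state sequence $S^n$ is i.i.d. with distribution $p(s)$. The channel is memoryless: $p(y_i,z_i|x^i,y^{i-1},z^{i-1},s_i)=p(y_i,z_i|x_i,s_i)$; $Y$ is the legitimate receiver's output, $Z$ the eavesdropper's output. The state is known causally (i.e. $s^i$ at time $i$) to both the encoder and the legitimate decoder. A secure feedback link (not observed by the eavesdropper) from decoder to encoder carries symbols $K^f_i\in\mathcal K^f_i$, $i=1,\dots,n$, with $\frac1n\sum_{i=1}^n\log|\mathcal K^f_i|\le R_f$; $K^f_i$ is generated randomly according to $p(k^f_i|y^{i-1},k_f^{i-1})$, where $k_f^{i-1}=(k^f_1,\dots,k^f_{i-1})$. A $(2^{nR},2^{nR_f},n)$ code consists of a message set $\{1,\dots,2^{nR}\}$ with message $M$ uniform on it, such feedback, a stochastic encoder $p(x_i|m,x^{i-1},s^i,k_f^i)$, and a decoder $\hat m:\mathcal Y^n\times\mathcal S^n\times\mathcal K^n_f\to\{1,\dots,2^{nR}\}$, $\hat M=\hat m(Y^n,S^n,K_f^n)$; $P_e^{(n)}=\Pr(\hat M\ne M)$. A rate $R$ is securely achievable if for every $\varepsilon>0$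 there exists a $(2^{nR},2^{nR_f},n)$ code with $H(M|Z^n)/H(M)\ge 1-\varepsilon$ and $P_e^{(n)}\le\varepsilon$. The secrecy capacity $C_S$ is the supremum of securely achievable rates. *)

theory Defs
  imports Complex_Main
begin

text \<open>A finite outcome space Om with a probability mass function P on it.
  Random variables are functions on outcomes.  Logarithms are to base 2.\<close>

definition prob_of :: "'w set \<Rightarrow> ('w \<Rightarrow> real) \<Rightarrow> ('w \<Rightarrow> bool) \<Rightarrow> real" where
  "prob_of Om P A = (\<Sum>w\<in>{w\<in>Om. A w}. P w)"

definition cond_ent :: "'w set \<Rightarrow> ('w \<Rightarrow> real) \<Rightarrow> ('w \<Rightarrow> 'a) \<Rightarrow> ('w \<Rightarrow> 'b) \<Rightarrow> real" where
  "cond_ent Om P X Y =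
     - (\<Sum>w\<in>Om. P w * log 2 (prob_of Om P (\<lambda>v. X v = X w \<and> Y v = Y w)
                               / prob_of Om P (\<lambda>v. Y v = Y w)))"

definition ent :: "'w set \<Rightarrow> ('w \<Rightarrow> real) \<Rightarrow> ('w \<Rightarrow> 'a) \<Rightarrow> real" where
  "ent Om P X = cond_ent Om P X (\<lambda>_. ())"

definition cond_mi :: "'w set \<Rightarrow> ('w \<Rightarrow> real) \<Rightarrow> ('w \<Rightarrow> 'a) \<Rightarrow> ('w \<Rightarrow> 'b) \<Rightarrow> ('w \<Rightarrow> 'c) \<Rightarrow> real" where
  "cond_mi Om P X Y Z = cond_ent Om P X Z - cond_ent Om P X (\<lambda>w. (Y w, Z w))"

definition is_pmf :: "('a::finite \<Rightarrow> real) \<Rightarrow> bool" where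
  "is_pmf p \<longleftrightarrow> (\<forall>a. 0 \<le> p a) \<and> (\<Sum>a\<in>UNIV. p a) = 1"

definition valid_channel :: "('x::finite \<Rightarrow> 's::finite \<Rightarrow> 'y::finite \<Rightarrow> 'z::finite \<Rightarrow> real) \<Rightarrow> bool" where
  "valid_channel W \<longleftrightarrow> (\<forall>x s. (\<forall>y z. 0 \<le> W x s y z) \<and> (\<Sum>y\<in>UNIV. \<Sum>z\<in>UNIV. W x s y z) = 1)"

text \<open>Time indices are 0,...,n-1 (time i of the paper is index i-1).
  Kf i : the (finite, nonempty) feedback alphabet at time index i (symbols coded as naturals).
  kf i ys ks k : probability p(k_i = k | y^{i-1} = ys, k_f^{i-1} = ks).
  enc i m xs ss ks x : probability p(x_i = x | m, x^{i-1} = xs, s^i = ss, k_f^i = ks).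
  dec ys ss ks : the decoded message.
  Messages are 1..Mn.\<close>

definition is_code ::
  "nat \<Rightarrow> nat \<Rightarrow> real \<Rightarrow> (nat \<Rightarrow> nat set) \<Rightarrow> (nat \<Rightarrow> 'y list \<Rightarrow> nat list \<Rightarrow> nat \<Rightarrow> real)
   \<Rightarrow> (nat \<Rightarrow> nat \<Rightarrow> 'x::finite list \<Rightarrow> 's list \<Rightarrow> nat list \<Rightarrow> 'x \<Rightarrow> real)
   \<Rightarrow> ('y list \<Rightarrow> 's list \<Rightarrow> nat list \<Rightarrow> nat) \<Rightarrow> bool" where
  "is_code n Mn Rf Kf kf enc dec \<longleftrightarrow>
     (\<forall>i<n. finite (Kf i) \<and> Kf i \<noteq> {}) \<and>
     (1 / real n) * (\<Sum>i<n. log 2 (real (card (Kf i)))) \<le> Rf \<and>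
     (\<forall>i<n. \<forall>ys ks. (\<forall>k. 0 \<le> kf i ys ks k) \<and> (\<Sum>k\<in>Kf i. kf i ys ks k) = 1) \<and>
     (\<forall>i<n. \<forall>m xs ss ks. (\<forall>x. 0 \<le> enc i m xs ss ks x) \<and> (\<Sum>x\<in>UNIV. enc i m xs ss ks x) = 1) \<and>
     (\<forall>ys ss ks. dec ys ss ks \<in> {1..Mn})"

definition code_space :: "nat \<Rightarrow> nat \<Rightarrow> (nat \<Rightarrow> nat set) \<Rightarrow>
    (nat \<times> 's list \<times> 'x list \<times> 'y list \<times> 'z list \<times> nat list) set" where
  "code_space n Mn Kf = {(m, ss, xs, ys, zs, ks). m \<in> {1..Mn} \<and> length ss = n \<and> length xs = n \<and>
      length ys = n \<and> length zs = n \<and> length ks = n \<and> (\<forall>i<n. ks ! i \<in> Kf i)}"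

definition code_pmf ::
  "('s \<Rightarrow> real) \<Rightarrow> ('x \<Rightarrow> 's \<Rightarrow> 'y \<Rightarrow> 'z \<Rightarrow> real) \<Rightarrow> nat \<Rightarrow> nat
   \<Rightarrow> (nat \<Rightarrow> 'y list \<Rightarrow> nat list \<Rightarrow> nat \<Rightarrow> real)
   \<Rightarrow> (nat \<Rightarrow> nat \<Rightarrow> 'x list \<Rightarrow> 's list \<Rightarrow> nat list \<Rightarrow> 'x \<Rightarrow> real)
   \<Rightarrow> (nat \<times> 's list \<times> 'x list \<times> 'y list \<times> 'z list \<times> nat list) \<Rightarrow> real" where
  "code_pmf ps W n Mn kf enc = (\<lambda>(m, ss, xs, ys, zs, ks).
     (1 / real Mn) * (\<Prod>i<n. ps (ss ! i) * kf i (take i ys) (take i ks) (ks ! i)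
        * enc i m (take i xs) (take (Suc i) ss) (take (Suc i) ks) (xs ! i)
        * W (xs ! i) (ss ! i) (ys ! i) (zs ! i)))"

definition securely_achievable ::
  "('s::finite \<Rightarrow> real) \<Rightarrow> ('x::finite \<Rightarrow> 's \<Rightarrow> 'y::finite \<Rightarrow> 'z::finite \<Rightarrow> real) \<Rightarrow> real \<Rightarrow> real \<Rightarrow> bool" where
  "securely_achievable ps W Rf R \<longleftrightarrow>
     (\<forall>\<epsilon>>0. \<exists>n>0. \<exists>Kf kf enc dec.
        (let Mn = nat \<lceil>2 powr (real n * R)\<rceil>;
             Om = code_space n Mn Kf;
             P = code_pmf ps W n Mn kf enc;
             M = (\<lambda>(m, ss, xs, ys, zs, ks). m);
             Zn = (\<lambda>(m, ss, xs, ys, zs, ks). zs)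
         in is_code n Mn Rf Kf kf enc dec \<and>
            cond_ent Om P M Zn / ent Om P M \<ge> 1 - \<epsilon> \<and>
            prob_of Om P (\<lambda>(m, ss, xs, ys, zs, ks). dec ys ss ks \<noteq> m) \<le> \<epsilon>))"

definition valid_cond :: "('s::finite \<Rightarrow> 'x::finite \<Rightarrow> real) \<Rightarrow> bool" where
  "valid_cond q \<longleftrightarrow> (\<forall>s. is_pmf (q s))"

definition single_pmf :: "('s \<Rightarrow> real) \<Rightarrow> ('s \<Rightarrow> 'x \<Rightarrow> real) \<Rightarrow> ('x \<Rightarrow> 's \<Rightarrow> 'y \<Rightarrow> 'z \<Rightarrow> real)
   \<Rightarrow> ('s \<times> 'x \<times> 'y \<times> 'z) \<Rightarrow> real" where
  "single_pmf ps q W = (\<lambda>(s, x, y, z). ps s * q s x * W x s y z)"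

definition bound_fun ::
  "('s::finite \<Rightarrow> real) \<Rightarrow> ('x::finite \<Rightarrow> 's \<Rightarrow> 'y::finite \<Rightarrow> 'z::finite \<Rightarrow> real) \<Rightarrow> real
   \<Rightarrow> ('s \<Rightarrow> 'x \<Rightarrow> real) \<Rightarrow> real" where
  "bound_fun ps W Rf q =
    (let P = single_pmf ps q W;
         S = (\<lambda>(s, x, y, z). s); X = (\<lambda>(s, x, y, z). x);
         Y = (\<lambda>(s, x, y, z). y); Z = (\<lambda>(s, x, y, z). z)
     in min (cond_mi UNIV P X Y (\<lambda>w. (Z w, S w)) + cond_ent UNIV P S Z + Rf)
            (cond_mi UNIV P X Y S))"

end

theory Submission
  imports Defs
begin

text \<open>
  Let \<open>A\<^sub>i = (M, S\<^sup>i, X\<^sup>i, K\<^sup>i)\<close>, \<open>B\<^sub>i = (Y\<^sup>i, S\<^sup>i, K\<^sup>i)\<close> and \<open>E\<^sub>i = Z\<^sup>i\<close> be what the encoder, the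
  decoder and the eavesdropper know after \<open>i\<close> channel uses. The secret information
  \<open>I(A\<^sub>i; B\<^sub>i | E\<^sub>i)\<close> grows in one use by at most
  \<open>log |K\<^sub>i| + H(S\<^sub>i | Z\<^sub>i) + I(X\<^sub>i; Y\<^sub>i | Z\<^sub>i, S\<^sub>i)\<close>, and \<open>I(M; B\<^sub>i)\<close> grows by at most
  \<open>I(X\<^sub>i; Y\<^sub>i | S\<^sub>i)\<close>. By Fano's inequality and the secrecy constraint, the message entropy is at
  most the final value of either quantity, up to an error. Both single-letter expressions are
  concave in \<open>p(x|s)\<close>, so the sums over time are bounded by the values at the time average of
  the induced input distributions. Fano's inequality is needed with an error term that
  vanishes with \<open>\<epsilon>\<close> alone, since the block length need not tend to infinity.
\<close>

section \<open>Entropy on a finite probability space\<close>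

lemma prob_of_split:
  assumes "finite Om" "finite J" "\<And>w. w \<in> Om \<Longrightarrow> A w \<Longrightarrow> f w \<in> J"
  shows "prob_of Om P A = (\<Sum>j\<in>J. prob_of Om P (\<lambda>w. A w \<and> f w = j))"
proof -
  have "prob_of Om P A = (\<Sum>j\<in>J. \<Sum>w\<in>{w\<in>{w\<in>Om. A w}. f w = j}. P w)"
    unfolding prob_of_def using assms
    by (intro sum.group[symmetric]) auto
  then show ?thesis by (simp add: prob_of_def conj_assoc)
qed

lemma prob_of_cong: "(\<And>w. w \<in> Om \<Longrightarrow> A w = B w) \<Longrightarrow> prob_of Om P A = prob_of Om P B"
  unfolding prob_of_def by (rule sum.cong) auto

locale finite_prob =
  fixes Om :: "'w set" and P :: "'w \<Rightarrow> real"
  assumes finite_Om: "finite Om"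
    and P_nonneg: "w \<in> Om \<Longrightarrow> 0 \<le> P w"
    and P_total: "sum P Om = 1"
begin

abbreviation pr :: "('w \<Rightarrow> bool) \<Rightarrow> real" where "pr \<equiv> prob_of Om P"
abbreviation H :: "('w \<Rightarrow> 'a) \<Rightarrow> real" where "H \<equiv> ent Om P"

text \<open>Functional dependence replaces measurability. Imposing it at null outcomes too lets
  fibres be compared as sets.\<close>

definition determines :: "('w \<Rightarrow> 'a) \<Rightarrow> ('w \<Rightarrow> 'b) \<Rightarrow> bool" where
  "determines X Y \<longleftrightarrow> (\<forall>v\<in>Om. \<forall>w\<in>Om. X v = X w \<longrightarrow> Y v = Y w)"

lemma pr_nonneg: "0 \<le> pr A"
  unfolding prob_of_def by (rule sum_nonneg) (auto intro: P_nonneg)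

lemma pr_True: "pr (\<lambda>_. True) = 1"
  by (simp add: prob_of_def P_total)

lemma pr_mono: "(\<And>w. w \<in> Om \<Longrightarrow> A w \<Longrightarrow> B w) \<Longrightarrow> pr A \<le> pr B"
  unfolding prob_of_def by (rule sum_mono2) (auto intro: P_nonneg simp: finite_Om)

lemma P_le_pr: "w \<in> Om \<Longrightarrow> A w \<Longrightarrow> P w \<le> pr A"
  unfolding prob_of_def using finite_Om P_nonneg
  by (intro member_le_sum) auto

lemma pr_pos: "w \<in> Om \<Longrightarrow> 0 < P w \<Longrightarrow> A w \<Longrightarrow> 0 < pr A"
  using P_le_pr[of w A] by linarith

lemma P_cases: "w \<in> Om \<Longrightarrow> P w = 0 \<or> 0 < P w"
  using P_nonneg[of w] by linarith

lemmas pr_split = prob_of_split[OF finite_Om]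

lemma ent_alt: "H X = - (\<Sum>w\<in>Om. P w * log 2 (pr (\<lambda>v. X v = X w)))"
  by (simp add: ent_def cond_ent_def pr_True)

lemma cond_ent_eq: "cond_ent Om P X Y = H (\<lambda>w. (X w, Y w)) - H Y"
proof -
  have "P w * log 2 (pr (\<lambda>v. X v = X w \<and> Y v = Y w) / pr (\<lambda>v. Y v = Y w))
      = P w * log 2 (pr (\<lambda>v. X v = X w \<and> Y v = Y w)) - P w * log 2 (pr (\<lambda>v. Y v = Y w))"
    if w: "w \<in> Om" for w
  \<comment> \<open>Null outcomes carry weight 0; elsewhere both probabilities are positive, so the
    logarithm of the quotient splits.\<close>
  proof (cases "P w = 0")
    case False
    then have "0 < P w" using P_cases w by auto
    then have "pr (\<lambda>v. X v = X w \<and> Y v = Y w) > 0" "pr (\<lambda>v. Y v = Y w) > 0"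
      using pr_pos w by auto
    then show ?thesis by (simp add: log_divide right_diff_distrib)
  qed simp
  then have "(\<Sum>w\<in>Om. P w * log 2 (pr (\<lambda>v. X v = X w \<and> Y v = Y w) / pr (\<lambda>v. Y v = Y w)))
    = (\<Sum>w\<in>Om. P w * log 2 (pr (\<lambda>v. X v = X w \<and> Y v = Y w)))
      - (\<Sum>w\<in>Om. P w * log 2 (pr (\<lambda>v. Y v = Y w)))"
    by (simp add: sum_subtractf)
  then show ?thesis unfolding cond_ent_def ent_alt by simp
qed

text \<open>Entropy sees only the partition of \<open>Om\<close> into fibres. This justifies every
  reordering or recoding of tuples below.\<close>

lemma ent_cong:
  assumes "determines X Y" "determines Y X"
  shows "H X = H Y"
proof -
  have "pr (\<lambda>v. X v = X w) = pr (\<lambda>v. Y v = Y w)" if "w \<in> Om" for w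
    using that assms unfolding determines_def by (intro prob_of_cong) blast
  then show ?thesis unfolding ent_alt by simp
qed

lemma cond_mi_cong:
  assumes X: "determines X X'" "determines X' X"
    and Y: "determines Y Y'" "determines Y' Y"
    and Z: "determines Z Z'" "determines Z' Z"
  shows "cond_mi Om P X Y Z = cond_mi Om P X' Y' Z'"
proof -
  have "H (\<lambda>w. (X w, Z w)) = H (\<lambda>w. (X' w, Z' w))"
    using X Z by (intro ent_cong) (unfold determines_def prod.inject, blast+)
  moreover have "H (\<lambda>w. (Y w, Z w)) = H (\<lambda>w. (Y' w, Z' w))"
    using Y Z by (intro ent_cong) (unfold determines_def prod.inject, blast+)
  moreover have "H (\<lambda>w. (X w, Y w, Z w)) = H (\<lambda>w. (X' w, Y' w, Z' w))"
    using X Y Z by (intro ent_cong) (unfold determines_def prod.inject, blast+)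
  moreover have "H Z = H Z'" using Z by (rule ent_cong)
  ultimately show ?thesis by (simp add: cond_mi_def cond_ent_eq)
qed

section \<open>Gibbs' inequality and the entropy inequalities derived from it\<close>

text \<open>Apply \<open>ln t \<le> t - 1\<close> to the ratio of the test kernel \<open>Q\<close>
  and the true conditional law: the mean of this ratio is at most 1. Later bounds differ only in the
  choice of \<open>Q\<close>.\<close>

lemma gibbs:
  assumes nonneg: "\<And>a w. w \<in> Om \<Longrightarrow> 0 \<le> Q a w"
    and sub: "\<And>w. w \<in> Om \<Longrightarrow> (\<Sum>a\<in>X ` Om. Q a w) \<le> 1"
    and pos: "\<And>w. w \<in> Om \<Longrightarrow> 0 < P w \<Longrightarrow> 0 < Q (X w) w"
    and cong: "\<And>a v w. v \<in> Om \<Longrightarrow> w \<in> Om \<Longrightarrow> Y v = Y w \<Longrightarrow> Q a v = Q a w"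
  shows "cond_ent Om P X Y \<le> - (\<Sum>w\<in>Om. P w * log 2 (Q (X w) w))"
proof -
  define p where "p w = pr (\<lambda>v. X v = X w \<and> Y v = Y w)" for w
  define r where "r w = pr (\<lambda>v. Y v = Y w)" for w
  have ppos: "0 < p w" "0 < r w" if "w \<in> Om" "0 < P w" for w
    unfolding p_def r_def using that by (auto intro: pr_pos)
  have summand: "P w * log 2 (Q (X w) w) - P w * log 2 (p w / r w)
      \<le> (P w * (r w * Q (X w) w / p w) - P w) / ln 2" if w: "w \<in> Om" for w
  proof (cases "P w = 0")
    case False
    then have Pw: "0 < P w" using P_cases w by auto
    note pp = ppos[OF w Pw] pos[OF w Pw]
    have "ln (r w * Q (X w) w / p w) \<le> r w * Q (X w) w / p w - 1"
      using pp by (intro ln_le_minus_one) simp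
    moreover have "log 2 (Q (X w) w) - log 2 (p w / r w) = ln (r w * Q (X w) w / p w) / ln 2"
      using pp by (simp add: log_def ln_div ln_mult diff_divide_distrib add_divide_distrib)
    ultimately have "log 2 (Q (X w) w) - log 2 (p w / r w) \<le> (r w * Q (X w) w / p w - 1) / ln 2"
      by (simp add: divide_right_mono)
    then have "P w * (log 2 (Q (X w) w) - log 2 (p w / r w))
        \<le> P w * ((r w * Q (X w) w / p w - 1) / ln 2)"
      using Pw by (intro mult_left_mono) auto
    then show ?thesis by (simp add: algebra_simps)
  qed simp
  \<comment> \<open>On a fibre of \<open>Y\<close>, grouping by the value of \<open>X\<close>
    cancels \<open>P\<close> against \<open>p\<close> and leaves a sum of \<open>Q\<close>. A group
    of probability 0 contributes 0 instead of \<open>Q a v\<close>, hence an inequality.\<close>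
  have inner: "(\<Sum>w\<in>{w\<in>Om. Y w = Y v}. P w * (Q (X w) w / p w)) \<le> 1" if v: "v \<in> Om" for v
  proof -
    have "(\<Sum>w\<in>{w\<in>Om. Y w = Y v}. P w * (Q (X w) w / p w))
        = (\<Sum>a\<in>X ` Om. \<Sum>w\<in>{w\<in>{w\<in>Om. Y w = Y v}. X w = a}. P w * (Q (X w) w / p w))"
      using finite_Om by (intro sum.group[symmetric]) auto
    also have "\<dots> \<le> (\<Sum>a\<in>X ` Om. Q a v)"
    proof (rule sum_mono)
      fix a
      let ?p = "pr (\<lambda>u. X u = a \<and> Y u = Y v)"
      have "(\<Sum>w\<in>{w\<in>{w\<in>Om. Y w = Y v}. X w = a}. P w * (Q (X w) w / p w))
          = (\<Sum>w\<in>{w\<in>Om. X w = a \<and> Y w = Y v}. P w * (Q a v / ?p))"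
      proof (rule sum.cong)
        fix w assume "w \<in> {w\<in>Om. X w = a \<and> Y w = Y v}"
        then have w: "w \<in> Om" "X w = a" "Y w = Y v" by auto
        have "Q (X w) w = Q a v" using cong[OF w(1) v w(3)] w(2) by simp
        then show "P w * (Q (X w) w / p w) = P w * (Q a v / ?p)" by (simp add: p_def w)
      qed auto
      also have "\<dots> = ?p * (Q a v / ?p)"
        by (simp only: prob_of_def sum_distrib_right)
      also have "\<dots> \<le> Q a v" using nonneg[OF v] by (cases "?p = 0") auto
      finally show "(\<Sum>w\<in>{w\<in>{w\<in>Om. Y w = Y v}. X w = a}. P w * (Q (X w) w / p w)) \<le> Q a v" .
    qed
    also have "\<dots> \<le> 1" using sub[OF v] .
    finally show ?thesis .
  qed
  \<comment> \<open>Writing \<open>r w\<close> as a sum over the fibre of \<open>Y\<close> through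
    \<open>w\<close> and swapping the two sums turns the mean of the ratio into an average of the
    fibre sums bounded in \<open>inner\<close>.\<close>
  have "(\<Sum>w\<in>Om. P w * (r w * Q (X w) w / p w))
      = (\<Sum>w\<in>Om. \<Sum>v\<in>{v\<in>Om. Y v = Y w}. P v * (P w * (Q (X w) w / p w)))"
    by (simp add: r_def prob_of_def sum_distrib_left sum_distrib_right sum_divide_distrib mult_ac)
  also have "\<dots> = (\<Sum>v\<in>Om. \<Sum>w\<in>{w\<in>Om. Y v = Y w}. P v * (P w * (Q (X w) w / p w)))"
    by (rule sum.swap_restrict[OF finite_Om finite_Om])
  also have "\<dots> = (\<Sum>v\<in>Om. P v * (\<Sum>w\<in>{w\<in>Om. Y w = Y v}. P w * (Q (X w) w / p w)))"
    by (simp add: sum_distrib_left eq_commute)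
  also have "\<dots> \<le> (\<Sum>v\<in>Om. P v * 1)"
    using inner P_nonneg by (intro sum_mono mult_left_mono) auto
  finally have le1: "(\<Sum>w\<in>Om. P w * (r w * Q (X w) w / p w)) \<le> 1" by (simp add: P_total)
  have "(\<Sum>w\<in>Om. P w * log 2 (Q (X w) w)) - (\<Sum>w\<in>Om. P w * log 2 (p w / r w))
      \<le> (\<Sum>w\<in>Om. (P w * (r w * Q (X w) w / p w) - P w) / ln 2)"
    unfolding sum_subtractf[symmetric] by (rule sum_mono) (rule summand)
  also have "\<dots> = ((\<Sum>w\<in>Om. P w * (r w * Q (X w) w / p w)) - 1) / ln 2"
    by (simp only: sum_divide_distrib[symmetric] sum_subtractf P_total)
  also have "\<dots> \<le> 0" using le1 by (simp add: divide_nonpos_nonneg)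
  finally show ?thesis unfolding cond_ent_def p_def r_def by simp
qed

text \<open>Only an inequality: if \<open>d\<close> has probability 0, all the quotients are
  0.\<close>

lemma cond_prob_sum_le_1:
  "(\<Sum>a\<in>X ` Om. pr (\<lambda>v. X v = a \<and> D v = d) / pr (\<lambda>v. D v = d)) \<le> 1"
proof -
  have "pr (\<lambda>v. D v = d) = (\<Sum>a\<in>X ` Om. pr (\<lambda>v. D v = d \<and> X v = a))"
    using finite_Om by (intro pr_split) auto
  then have "(\<Sum>a\<in>X ` Om. pr (\<lambda>v. X v = a \<and> D v = d) / pr (\<lambda>v. D v = d))
      = pr (\<lambda>v. D v = d) / pr (\<lambda>v. D v = d)"
    unfolding sum_divide_distrib[symmetric] by (simp add: conj_commute)
  then show ?thesis by simp
qed

text \<open>Gibbs with \<open>Q\<close> the true conditional law of \<open>X\<close> given the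
  coarser variable \<open>D\<close>.\<close>

lemma cond_ent_antimono:
  assumes "determines Y D"
  shows "cond_ent Om P X Y \<le> cond_ent Om P X D"
proof -
  define Q where "Q a w = pr (\<lambda>v. X v = a \<and> D v = D w) / pr (\<lambda>v. D v = D w)" for a w
  have "cond_ent Om P X Y \<le> - (\<Sum>w\<in>Om. P w * log 2 (Q (X w) w))"
  proof (rule gibbs)
    show "(\<Sum>a\<in>X ` Om. Q a w) \<le> 1" for w
      unfolding Q_def by (rule cond_prob_sum_le_1)
    show "0 < Q (X w) w" if "w \<in> Om" "0 < P w" for w
      unfolding Q_def using that by (intro divide_pos_pos pr_pos) auto
    show "Q a v = Q a w" if "v \<in> Om" "w \<in> Om" "Y v = Y w" for a v w
    proof -
      have "D v = D w" using assms that unfolding determines_def by blast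
      then show ?thesis by (simp add: Q_def)
    qed
  qed (simp add: Q_def pr_nonneg)
  also have "\<dots> = cond_ent Om P X D" by (simp add: cond_ent_def Q_def)
  finally show ?thesis .
qed

lemma ent_mono:
  assumes "determines X Y"
  shows "H Y \<le> H X"
proof -
  have "P w * log 2 (pr (\<lambda>v. X v = X w)) \<le> P w * log 2 (pr (\<lambda>v. Y v = Y w))" if w: "w \<in> Om" for w
  proof (cases "P w = 0")
    case False
    then have "0 < P w" using P_cases w by auto
    moreover have "pr (\<lambda>v. X v = X w) \<le> pr (\<lambda>v. Y v = Y w)"
      using assms w unfolding determines_def by (intro pr_mono) blast
    moreover have "0 < pr (\<lambda>v. X v = X w)" using w calculation by (intro pr_pos) auto
    ultimately show ?thesis by (intro mult_left_mono) auto
  qed simp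
  then show ?thesis unfolding ent_alt by (simp add: sum_mono)
qed

text \<open>Conditioning reduces entropy, in a form that mentions functional dependence only. It
  reduces each information inequality below to linear arithmetic over joint entropies.\<close>

lemma ent_submodular:
  assumes "determines (\<lambda>w. (A w, B w)) U" "determines A D" "determines B D"
  shows "H U + H D \<le> H A + H B"
proof -
  have "H (\<lambda>w. (A w, B w)) - H B \<le> H (\<lambda>w. (A w, D w)) - H D"
    using cond_ent_antimono[OF assms(3), of A] by (simp add: cond_ent_eq)
  moreover have "H (\<lambda>w. (A w, D w)) = H A"
    using assms(2) unfolding determines_def
    by (intro ent_cong) (unfold determines_def prod.inject, blast+)
  ultimately show ?thesis using ent_mono[OF assms(1)] by linarith
qed

lemma ent_const: "H (\<lambda>_. c) = 0"
  by (simp add: ent_alt pr_True)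

lemma ent_pair_le: "H (\<lambda>w. (X w, Y w)) \<le> H X + H Y"
  using ent_submodular[of X Y "\<lambda>w. (X w, Y w)" "\<lambda>_. ()"]
  by (auto simp: determines_def ent_const)

text \<open>Gibbs with the uniform distribution on \<open>J\<close>.\<close>

lemma ent_le_log_card:
  assumes "finite J" "\<And>w. w \<in> Om \<Longrightarrow> X w \<in> J"
  shows "H X \<le> log 2 (real (card J))"
proof -
  have "Om \<noteq> {}" using P_total by auto
  then have J: "card J > 0" using assms by (auto simp: card_gt_0_iff)
  have "cond_ent Om P X (\<lambda>_. ()) \<le> - (\<Sum>w\<in>Om. P w * log 2 (1 / real (card J)))"
  proof (rule gibbs)
    have "card (X ` Om) \<le> card J" using assms by (intro card_mono) auto
    then show "(\<Sum>a\<in>X ` Om. 1 / real (card J)) \<le> 1" using J by simp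
  qed (use J in auto)
  also have "\<dots> = log 2 (real (card J))"
    using J by (simp add: log_divide sum_distrib_right[symmetric] P_total sum_negf)
  finally show ?thesis by (simp add: ent_def)
qed

text \<open>If the law of \<open>X\<close> given the fine variable \<open>V\<close> depends on the
  value of \<open>T\<close> only, it is also the law given \<open>T\<close>, by summing over the
  fibres of \<open>V\<close> inside a fibre of \<open>T\<close>. Markov conditions are verified this
  way: two conditionings that share the same \<kappa> give the same conditional entropy.\<close>

lemma cond_ent_kernel:
  assumes det: "determines V T"
    and ker: "\<And>u w. u \<in> Om \<Longrightarrow> w \<in> Om \<Longrightarrow> T u = T w \<Longrightarrow>
      pr (\<lambda>v. X v = X w \<and> V v = V u) = pr (\<lambda>v. V v = V u) * \<kappa> w"
  shows "cond_ent Om P X T = - (\<Sum>w\<in>Om. P w * log 2 (\<kappa> w))"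
proof -
  have "pr (\<lambda>v. X v = X w \<and> T v = T w) = pr (\<lambda>v. T v = T w) * \<kappa> w" if w: "w \<in> Om" for w
  proof -
    let ?J = "V ` {u\<in>Om. T u = T w}"
    have fin: "finite ?J" using finite_Om by auto
    have VT: "T v = T w" if "v \<in> Om" "V v = V u" "u \<in> Om" "T u = T w" for u v
      using det that unfolding determines_def by metis
    have "pr (\<lambda>v. X v = X w \<and> T v = T w) = (\<Sum>j\<in>?J. pr (\<lambda>v. (X v = X w \<and> T v = T w) \<and> V v = j))"
      using fin by (intro pr_split) auto
    also have "\<dots> = (\<Sum>j\<in>?J. pr (\<lambda>v. X v = X w \<and> V v = j))"
      by (intro sum.cong refl prob_of_cong) (use VT in auto)
    also have "\<dots> = (\<Sum>j\<in>?J. pr (\<lambda>v. V v = j) * \<kappa> w)"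
      by (intro sum.cong refl) (use ker w in auto)
    also have "\<dots> = (\<Sum>j\<in>?J. pr (\<lambda>v. T v = T w \<and> V v = j)) * \<kappa> w"
      unfolding sum_distrib_right
      by (intro sum.cong refl arg_cong2[where f="(*)"] prob_of_cong) (use VT in auto)
    also have "(\<Sum>j\<in>?J. pr (\<lambda>v. T v = T w \<and> V v = j)) = pr (\<lambda>v. T v = T w)"
      using fin by (intro pr_split[symmetric]) auto
    finally show ?thesis .
  qed
  then have "P w * log 2 (pr (\<lambda>v. X v = X w \<and> T v = T w) / pr (\<lambda>v. T v = T w)) = P w * log 2 (\<kappa> w)"
    if w: "w \<in> Om" for w
    using that P_cases[OF w] pr_pos[OF w, of "\<lambda>v. T v = T w"] by auto
  then have "(\<Sum>w\<in>Om. P w * log 2 (pr (\<lambda>v. X v = X w \<and> T v = T w) / pr (\<lambda>v. T v = T w)))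
      = (\<Sum>w\<in>Om. P w * log 2 (\<kappa> w))"
    by (rule sum.cong[OF refl])
  then show ?thesis unfolding cond_ent_def by simp
qed

text \<open>Gibbs with a guess that puts mass \<open>1 - \<epsilon>\<close> on the decoded message
  and spreads \<epsilon> evenly over all \<open>N\<close> messages. Apart from
  \<open>\<epsilon> * log 2 N\<close>, the bound depends on \<epsilon> alone and vanishes with
  it.\<close>

lemma fano:
  assumes err: "pr (\<lambda>w. g (B w) \<noteq> M w) \<le> \<epsilon>" and eps: "0 < \<epsilon>" "\<epsilon> < 1"
    and M: "\<And>w. w \<in> Om \<Longrightarrow> M w \<in> {1..N::nat}" and N: "0 < N"
  shows "cond_ent Om P M B \<le> - log 2 (1 - \<epsilon>) - \<epsilon> * log 2 \<epsilon> + \<epsilon> * log 2 (real N)"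
proof -
  define Q where "Q a w = (if a = g (B w) then 1 - \<epsilon> else \<epsilon> / real N)" for a w
  let ?c = "log 2 (real N) - log 2 \<epsilon>"
  have "0 \<le> log 2 (real N)" "log 2 \<epsilon> \<le> 0" using eps N by simp_all
  then have c: "0 \<le> ?c" by linarith
  have "cond_ent Om P M B \<le> - (\<Sum>w\<in>Om. P w * log 2 (Q (M w) w))"
  proof (rule gibbs)
    show "(\<Sum>a\<in>M ` Om. Q a w) \<le> 1" if "w \<in> Om" for w
    proof -
      have fin: "finite (M ` Om)" using finite_Om by simp
      have "(\<Sum>a\<in>M ` Om. Q a w) \<le> (\<Sum>a\<in>M ` Om. (if a = g (B w) then 1 - \<epsilon> else 0) + \<epsilon> / real N)"
        using eps by (intro sum_mono) (auto simp: Q_def)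
      also have "\<dots> = (if g (B w) \<in> M ` Om then 1 - \<epsilon> else 0) + real (card (M ` Om)) * (\<epsilon> / real N)"
        unfolding sum.distrib using fin by (simp add: sum.delta)
      also have "real (card (M ` Om)) * (\<epsilon> / real N) \<le> real N * (\<epsilon> / real N)"
      proof (rule mult_right_mono)
        have "card (M ` Om) \<le> card {1..N}" using M by (intro card_mono) auto
        then show "real (card (M ` Om)) \<le> real N" by simp
      qed (use eps in auto)
      finally show ?thesis using eps N by (simp split: if_splits)
    qed
  qed (use eps N in \<open>auto simp: Q_def\<close>)
  also have "\<dots> = (\<Sum>w\<in>Om. P w * - log 2 (Q (M w) w))" by (simp add: sum_negf)
  \<comment> \<open>Every outcome is charged \<open>- log 2 (1 - \<epsilon>)\<close>; a wrongly
    decoded one is charged the cost \<open>?c\<close> of \<open>\<epsilon> / N\<close> on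
    top.\<close>
  also have "\<dots> \<le> (\<Sum>w\<in>Om. P w * - log 2 (1 - \<epsilon>) + (if g (B w) \<noteq> M w then P w * ?c else 0))"
  proof (rule sum_mono)
    fix w assume w: "w \<in> Om"
    have "0 \<le> P w * - log 2 (1 - \<epsilon>)" using eps P_nonneg[OF w] by (intro mult_nonneg_nonneg) auto
    then show "P w * - log 2 (Q (M w) w)
      \<le> P w * - log 2 (1 - \<epsilon>) + (if g (B w) \<noteq> M w then P w * ?c else 0)"
      using eps N by (auto simp: Q_def log_divide algebra_simps)
  qed
  also have "\<dots> = - log 2 (1 - \<epsilon>) + pr (\<lambda>w. g (B w) \<noteq> M w) * ?c"
    unfolding sum.distrib sum_distrib_right[symmetric] P_total prob_of_def
      sum.inter_filter[OF finite_Om]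
    by (simp add: sum_distrib_right if_distrib[of "\<lambda>x. x * _"] cong: if_cong)
  also have "\<dots> \<le> - log 2 (1 - \<epsilon>) + \<epsilon> * ?c" using err c by (simp add: mult_right_mono)
  finally show ?thesis by (simp add: algebra_simps)
qed

section \<open>Growth of information in one channel use\<close>

text \<open>Here \<open>A\<close>, \<open>B\<close>, \<open>E\<close> are the past views of encoder, decoder and eavesdropper. Including the
  inputs in \<open>A\<close> is what makes the bound go through: the feedback symbol \<open>K\<close> may reveal earlier
  outputs, so the outputs are not conditionally memoryless given the message and all feedback.\<close>

lemma secret_information_step:
  assumes K: "cond_ent Om P K (\<lambda>w. (A w, B w, E w)) = cond_ent Om P K (\<lambda>w. (B w, E w))"
    and SXZ: "cond_ent Om P (\<lambda>w. (S w, X w, Z w)) (\<lambda>w. (K w, A w, B w, E w))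
            = cond_ent Om P (\<lambda>w. (S w, X w, Z w)) (\<lambda>w. (K w, A w, E w))"
    and Y: "cond_ent Om P Y (\<lambda>w. (K w, A w, B w, E w, S w, X w, Z w))
          = cond_ent Om P Y (\<lambda>w. (X w, Z w, S w))"
  shows "cond_mi Om P (\<lambda>w. (A w, K w, S w, X w)) (\<lambda>w. (B w, K w, S w, Y w)) (\<lambda>w. (E w, Z w))
    \<le> cond_mi Om P A B E + H K + cond_ent Om P S Z
      + (cond_ent Om P Y (\<lambda>w. (Z w, S w)) - cond_ent Om P Y (\<lambda>w. (X w, Z w, S w)))"
proof -
  define L where "L = H (\<lambda>w. (Y w, X w, Z w, S w)) - H (\<lambda>w. (X w, Z w, S w))"
  define AE where "AE = H (\<lambda>w. (A w, E w))"
  define BE where "BE = H (\<lambda>w. (B w, E w))"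
  define ABE where "ABE = H (\<lambda>w. (A w, B w, E w))"
  define KBE where "KBE = H (\<lambda>w. (K w, B w, E w))"
  define KAE where "KAE = H (\<lambda>w. (K w, A w, E w))"
  define KABE where "KABE = H (\<lambda>w. (K w, A w, B w, E w))"
  define A1 where "A1 = H (\<lambda>w. ((S w, X w, Z w), K w, A w, E w))"
  define B1 where "B1 = H (\<lambda>w. ((B w, K w, S w, Y w), E w, Z w))"
  define U0 where "U0 = H (\<lambda>w. ((S w, X w, Z w), K w, A w, B w, E w))"
  define U1 where "U1 = H (\<lambda>w. (Y w, K w, A w, B w, E w, S w, X w, Z w))"
  define EZ where "EZ = H (\<lambda>w. (E w, Z w))"
  define BKSEZ where "BKSEZ = H (\<lambda>w. (B w, K w, S w, E w, Z w))"
  define SEZ where "SEZ = H (\<lambda>w. (S w, E w, Z w))"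
  define YZS where "YZS = H (\<lambda>w. (Y w, Z w, S w))"
  define ZS where "ZS = H (\<lambda>w. (Z w, S w))"
  have e1: "KABE - ABE = KBE - BE"
    using K by (simp add: cond_ent_eq KABE_def ABE_def KBE_def BE_def)
  have e2: "U0 - KABE = A1 - KAE"
    using SXZ by (simp add: cond_ent_eq KABE_def U0_def A1_def KAE_def)
  have e3: "U1 - U0 = L"
  proof -
    have "H (\<lambda>w. (K w, A w, B w, E w, S w, X w, Z w)) = U0"
      unfolding U0_def by (rule ent_cong) (auto simp: determines_def)
    then show ?thesis using Y by (simp add: cond_ent_eq U1_def L_def)
  qed
  \<comment> \<open>As conditional entropies: \<open>i1\<close> is H(K|A,E) \<le> H(K),
    \<open>i2\<close> is H(Y|B,K,S,E,Z) \<le> H(Y|Z,S), \<open>i3\<close> is H(S,Z|B,K,E) \<le>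
    H(S,Z|E), and \<open>i4\<close> is H(S|E,Z) \<le> H(S|Z). The feedback thus costs H(K) and the
    state H(S|Z).\<close>
  have i1: "KAE \<le> AE + H K"
    using ent_pair_le[of K "\<lambda>w. (A w, E w)"] by (simp add: KAE_def AE_def)
  have i2: "B1 + ZS \<le> BKSEZ + YZS"
    unfolding B1_def ZS_def BKSEZ_def YZS_def
    by (rule ent_submodular) (auto simp: determines_def)
  have i3: "BKSEZ + H E \<le> KBE + SEZ"
    unfolding SEZ_def BKSEZ_def KBE_def
    by (rule ent_submodular) (auto simp: determines_def)
  have i4: "SEZ + H Z \<le> EZ + H (\<lambda>w. (S w, Z w))"
    unfolding SEZ_def EZ_def
    by (rule ent_submodular) (auto simp: determines_def)
  have m0: "cond_mi Om P A B E = AE - H E - (ABE - BE)"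
    by (simp add: cond_mi_def cond_ent_eq AE_def ABE_def BE_def)
  have m1: "cond_mi Om P (\<lambda>w. (A w, K w, S w, X w)) (\<lambda>w. (B w, K w, S w, Y w)) (\<lambda>w. (E w, Z w))
      = A1 - EZ - (U1 - B1)"
  proof -
    have "H (\<lambda>w. ((A w, K w, S w, X w), E w, Z w)) = A1"
      unfolding A1_def by (rule ent_cong) (auto simp: determines_def)
    moreover have "H (\<lambda>w. ((A w, K w, S w, X w), (B w, K w, S w, Y w), E w, Z w)) = U1"
      unfolding U1_def by (rule ent_cong) (auto simp: determines_def)
    ultimately show ?thesis by (simp add: cond_mi_def cond_ent_eq EZ_def B1_def)
  qed
  have c1: "cond_ent Om P S Z = H (\<lambda>w. (S w, Z w)) - H Z"
    and c2: "cond_ent Om P Y (\<lambda>w. (Z w, S w)) = YZS - ZS"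
    and c3: "cond_ent Om P Y (\<lambda>w. (X w, Z w, S w)) = L"
    by (simp_all add: cond_ent_eq YZS_def ZS_def L_def)
  show ?thesis unfolding m0 m1 c1 c2 c3 using e1 e2 e3 i1 i2 i3 i4 by linarith
qed

lemma cond_mi_unit: "cond_mi Om P X Y (\<lambda>_. ()) = H X + H Y - H (\<lambda>w. (X w, Y w))"
proof -
  have "H (\<lambda>w. (X w, ())) = H X" "H (\<lambda>w. (Y w, ())) = H Y"
       "H (\<lambda>w. (X w, Y w, ())) = H (\<lambda>w. (X w, Y w))"
    by (rule ent_cong; auto simp: determines_def)+
  then show ?thesis by (simp add: cond_mi_def cond_ent_eq ent_const)
qed

text \<open>With \<open>C\<close> the decoder's past, a feedback symbol generated from
  \<open>C\<close> says nothing new about \<open>M\<close>, and neither does a fresh state. Only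
  \<open>Y\<close> does, and given \<open>X\<close> and \<open>S\<close> it depends on nothing
  else.\<close>

lemma information_step:
  assumes K: "cond_ent Om P K (\<lambda>w. (M w, C w)) = cond_ent Om P K C"
    and S: "cond_ent Om P S (\<lambda>w. (K w, M w, C w)) = H S"
    and Y: "cond_ent Om P Y (\<lambda>w. (S w, K w, M w, C w, X w)) = cond_ent Om P Y (\<lambda>w. (X w, S w))"
  shows "cond_mi Om P M (\<lambda>w. (C w, K w, S w, Y w)) (\<lambda>_. ())
    \<le> cond_mi Om P M C (\<lambda>_. ()) + (cond_ent Om P Y S - cond_ent Om P Y (\<lambda>w. (X w, S w)))"
proof -
  have e1: "H (\<lambda>w. (K w, M w, C w)) - H (\<lambda>w. (M w, C w)) = H (\<lambda>w. (K w, C w)) - H C"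
    using K by (simp add: cond_ent_eq)
  have e2: "H (\<lambda>w. (S w, K w, M w, C w)) - H (\<lambda>w. (K w, M w, C w)) = H S"
    using S by (simp add: cond_ent_eq)
  have e3: "H (\<lambda>w. (Y w, S w, K w, M w, C w, X w)) - H (\<lambda>w. (S w, K w, M w, C w, X w))
      = cond_ent Om P Y (\<lambda>w. (X w, S w))"
    using Y by (simp add: cond_ent_eq)
  \<comment> \<open>\<open>i1\<close> adds \<open>X\<close> to the conditioning of \<open>Y\<close>,
    so that the channel hypothesis applies; \<open>i2\<close> drops the past from H(Y|S,K,C);
    \<open>i3\<close> does so for the state.\<close>
  have i1: "H (\<lambda>w. (Y w, S w, K w, M w, C w, X w)) + H (\<lambda>w. (S w, K w, M w, C w))
      \<le> H (\<lambda>w. (S w, K w, M w, C w, X w)) + H (\<lambda>w. (M w, C w, K w, S w, Y w))"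
    by (rule ent_submodular) (auto simp: determines_def)
  have i2: "H (\<lambda>w. (C w, K w, S w, Y w)) + H S \<le> H (\<lambda>w. (S w, K w, C w)) + H (\<lambda>w. (Y w, S w))"
    by (rule ent_submodular) (auto simp: determines_def)
  have i3: "H (\<lambda>w. (S w, K w, C w)) \<le> H S + H (\<lambda>w. (K w, C w))"
    by (rule ent_pair_le)
  have c: "cond_ent Om P Y S = H (\<lambda>w. (Y w, S w)) - H S" by (rule cond_ent_eq)
  show ?thesis unfolding cond_mi_unit c using e1 e2 e3 i1 i2 i3 by linarith
qed

lemma cond_mi_commute:
  "cond_mi Om P X Y Z = cond_ent Om P Y Z - cond_ent Om P Y (\<lambda>w. (X w, Z w))"
proof -
  have "H (\<lambda>w. (X w, Y w, Z w)) = H (\<lambda>w. (Y w, X w, Z w))"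
    by (rule ent_cong) (auto simp: determines_def)
  then show ?thesis by (simp add: cond_mi_def cond_ent_eq)
qed

lemma cond_mi_le:
  assumes "determines A M"
  shows "cond_mi Om P M B E \<le> cond_mi Om P A B E"
proof -
  have "H (\<lambda>w. (A w, B w, E w)) + H (\<lambda>w. (M w, E w)) \<le> H (\<lambda>w. (A w, E w)) + H (\<lambda>w. (M w, B w, E w))"
    using assms by (intro ent_submodular) (unfold determines_def prod.inject, blast+)
  then show ?thesis by (simp add: cond_mi_def cond_ent_eq)
qed

lemma cond_ent_nonneg: "0 \<le> cond_ent Om P X Y"
  using ent_mono[of "\<lambda>w. (X w, Y w)" Y] by (simp add: cond_ent_eq determines_def)

lemma cond_ent_le_ent: "cond_ent Om P X Y \<le> H X"
  using ent_pair_le[of X Y] by (simp add: cond_ent_eq)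

text \<open>Conditional entropy sees only the joint law, so entropies on the code space can be
  evaluated under the law of a single channel use.\<close>

lemma cond_ent_pushforward:
  fixes f :: "'w \<Rightarrow> 'u::finite"
  shows "cond_ent UNIV (\<lambda>u. pr (\<lambda>w. f w = u)) X Y = cond_ent Om P (\<lambda>w. X (f w)) (\<lambda>w. Y (f w))"
proof -
  have p: "prob_of UNIV (\<lambda>u. pr (\<lambda>w. f w = u)) A = pr (\<lambda>w. A (f w))" for A
  proof -
    have "pr (\<lambda>w. A (f w)) = (\<Sum>u\<in>{u. A u}. pr (\<lambda>w. A (f w) \<and> f w = u))"
      by (rule pr_split) auto
    also have "\<dots> = (\<Sum>u\<in>{u. A u}. pr (\<lambda>w. f w = u))"
      by (intro sum.cong refl prob_of_cong) auto
    finally show ?thesis by (simp add: prob_of_def[of UNIV])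
  qed
  have "(\<Sum>u\<in>UNIV. pr (\<lambda>w. f w = u) * g u) = (\<Sum>w\<in>Om. P w * g (f w))" for g
  proof -
    have "(\<Sum>u\<in>UNIV. pr (\<lambda>w. f w = u) * g u) = (\<Sum>u\<in>UNIV. \<Sum>w\<in>{w\<in>Om. f w = u}. P w * g (f w))"
      by (simp add: prob_of_def sum_distrib_right)
    also have "\<dots> = (\<Sum>w\<in>Om. P w * g (f w))"
      using finite_Om by (intro sum.group) auto
    finally show ?thesis .
  qed
  then show ?thesis unfolding cond_ent_def p by simp
qed

end

text \<open>Gibbs once more: the conditional law under the average \<open>Pa\<close> serves as the
  test kernel for every \<open>p j\<close>. The resulting bounds are linear in \<open>p j\<close>
  and add up to \<open>N\<close> times the entropy under \<open>Pa\<close>.\<close>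

lemma cond_ent_concave:
  assumes fp: "\<And>j. j < N \<Longrightarrow> finite_prob Om (p j)" and N: "0 < (N::nat)"
    and avg: "\<And>w. w \<in> Om \<Longrightarrow> Pa w = (\<Sum>j<N. p j w) / real N"
  shows "(\<Sum>j<N. cond_ent Om (p j) X Y) \<le> real N * cond_ent Om Pa X Y"
proof -
  have nn: "0 \<le> p j w" if "j < N" "w \<in> Om" for j w using finite_prob.P_nonneg[OF fp] that by blast
  interpret a: finite_prob Om Pa
  proof
    show "finite Om" using finite_prob.finite_Om[OF fp[OF N]] .
    show "0 \<le> Pa w" if "w \<in> Om" for w
      using nn that by (auto simp: avg intro!: sum_nonneg divide_nonneg_nonneg)
    have "sum Pa Om = (\<Sum>j<N. sum (p j) Om) / real N"
      by (simp add: avg sum_divide_distrib[symmetric] sum.swap[of _ Om])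
    then show "sum Pa Om = 1" using finite_prob.P_total[OF fp] N by simp
  qed
  define Q where "Q x w = a.pr (\<lambda>v. X v = x \<and> Y v = Y w) / a.pr (\<lambda>v. Y v = Y w)" for x w
  have "cond_ent Om (p j) X Y \<le> - (\<Sum>w\<in>Om. p j w * log 2 (Q (X w) w))" if j: "j < N" for j
  proof -
    interpret finite_prob Om "p j" by (rule fp[OF j])
    show ?thesis
    proof (rule gibbs)
      show "(\<Sum>x\<in>X ` Om. Q x w) \<le> 1" for w
        unfolding Q_def by (rule a.cond_prob_sum_le_1)
      show "0 < Q (X w) w" if w: "w \<in> Om" "0 < p j w" for w
      proof -
        \<comment> \<open>The average charges every outcome that some \<open>p j\<close> charges, so
          the common kernel is positive where Gibbs requires it.\<close>
        have "p j w \<le> (\<Sum>j<N. p j w)" using nn w j by (intro member_le_sum) auto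
        then have "0 < Pa w" using w N by (simp add: avg)
        then show ?thesis unfolding Q_def using w by (intro divide_pos_pos a.pr_pos) auto
      qed
    qed (auto simp: Q_def a.pr_nonneg)
  qed
  then have "(\<Sum>j<N. cond_ent Om (p j) X Y) \<le> (\<Sum>j<N. - (\<Sum>w\<in>Om. p j w * log 2 (Q (X w) w)))"
    by (intro sum_mono) auto
  also have "\<dots> = - (\<Sum>w\<in>Om. (\<Sum>j<N. p j w) * log 2 (Q (X w) w))"
    by (simp add: sum_negf sum_distrib_right sum.swap[of _ Om])
  also have "\<dots> = - (\<Sum>w\<in>Om. real N * (Pa w * log 2 (Q (X w) w)))"
    using N by (intro arg_cong[where f=uminus] sum.cong refl) (simp add: avg)
  also have "\<dots> = real N * cond_ent Om Pa X Y"
    by (simp add: cond_ent_def Q_def sum_distrib_left)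
  finally show ?thesis .
qed

section \<open>The joint law of a code\<close>

type_synonym ('s, 'x, 'y, 'z) outcome =
  "nat \<times> 's list \<times> 'x list \<times> 'y list \<times> 'z list \<times> nat list"

definition msg :: "('s, 'x, 'y, 'z) outcome \<Rightarrow> nat" where
  "msg = (\<lambda>(m, ss, xs, ys, zs, ks). m)"
definition states :: "('s, 'x, 'y, 'z) outcome \<Rightarrow> 's list" where
  "states = (\<lambda>(m, ss, xs, ys, zs, ks). ss)"
definition inputs :: "('s, 'x, 'y, 'z) outcome \<Rightarrow> 'x list" where
  "inputs = (\<lambda>(m, ss, xs, ys, zs, ks). xs)"
definition outputs :: "('s, 'x, 'y, 'z) outcome \<Rightarrow> 'y list" where
  "outputs = (\<lambda>(m, ss, xs, ys, zs, ks). ys)"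
definition eaves :: "('s, 'x, 'y, 'z) outcome \<Rightarrow> 'z list" where
  "eaves = (\<lambda>(m, ss, xs, ys, zs, ks). zs)"
definition feedback :: "('s, 'x, 'y, 'z) outcome \<Rightarrow> nat list" where
  "feedback = (\<lambda>(m, ss, xs, ys, zs, ks). ks)"

lemmas component_defs = msg_def states_def inputs_def outputs_def eaves_def feedback_def

lemma component_simps [simp]:
  "msg (m, ss, xs, ys, zs, ks) = m" "states (m, ss, xs, ys, zs, ks) = ss"
  "inputs (m, ss, xs, ys, zs, ks) = xs" "outputs (m, ss, xs, ys, zs, ks) = ys"
  "eaves (m, ss, xs, ys, zs, ks) = zs" "feedback (m, ss, xs, ys, zs, ks) = ks"
  by (simp_all add: component_defs)

text \<open>A truncation is encoded as an outcome of a code of length \<open>i\<close>, so that its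
  probability is again given by \<open>code_pmf\<close>, with the shorter block length.\<close>

definition hist :: "nat \<Rightarrow> ('s, 'x, 'y, 'z) outcome \<Rightarrow> ('s, 'x, 'y, 'z) outcome" where
  "hist i w = (msg w, take i (states w), take i (inputs w), take i (outputs w),
     take i (eaves w), take i (feedback w))"

lemma take_Suc_eq_iff:
  "length xs = n \<Longrightarrow> length ys = n \<Longrightarrow> i < n \<Longrightarrow>
    take (Suc i) xs = take (Suc i) ys \<longleftrightarrow> take i xs = take i ys \<and> xs ! i = ys ! i"
  by (auto simp: take_Suc_conv_app_nth)

lemma take_Suc_eq_snoc_iff:
  "i < length xs \<Longrightarrow> length ys = i \<Longrightarrow>
    take (Suc i) xs = ys @ [y] \<longleftrightarrow> take i xs = ys \<and> xs ! i = y"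
  by (auto simp: take_Suc_conv_app_nth)

locale wiretap_code =
  fixes ps :: "'s::finite \<Rightarrow> real"
    and W :: "'x::finite \<Rightarrow> 's \<Rightarrow> 'y::finite \<Rightarrow> 'z::finite \<Rightarrow> real"
    and n Mn :: nat and Rf :: real and Kf :: "nat \<Rightarrow> nat set"
    and kf :: "nat \<Rightarrow> 'y list \<Rightarrow> nat list \<Rightarrow> nat \<Rightarrow> real"
    and enc :: "nat \<Rightarrow> nat \<Rightarrow> 'x list \<Rightarrow> 's list \<Rightarrow> nat list \<Rightarrow> 'x \<Rightarrow> real"
    and dec :: "'y list \<Rightarrow> 's list \<Rightarrow> nat list \<Rightarrow> nat"
  assumes ps: "is_pmf ps" and W: "valid_channel W" and Mn: "0 < Mn"
    and code: "is_code n Mn Rf Kf kf enc dec"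
begin

abbreviation space :: "('s, 'x, 'y, 'z) outcome set" where "space \<equiv> code_space n Mn Kf"
abbreviation pmf :: "('s, 'x, 'y, 'z) outcome \<Rightarrow> real" where "pmf \<equiv> code_pmf ps W n Mn kf enc"

lemma ps_nonneg: "0 \<le> ps s" and ps_sum: "(\<Sum>s\<in>UNIV. ps s) = 1"
  using ps by (auto simp: is_pmf_def)

lemma W_nonneg: "0 \<le> W x s y z" and W_sum: "(\<Sum>y\<in>UNIV. \<Sum>z\<in>UNIV. W x s y z) = 1"
  using W by (auto simp: valid_channel_def)

lemma Kf_finite: "i < n \<Longrightarrow> finite (Kf i)"
  and kf_nonneg: "i < n \<Longrightarrow> 0 \<le> kf i bs ks k" and kf_sum: "i < n \<Longrightarrow> (\<Sum>k\<in>Kf i. kf i bs ks k) = 1"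
  and enc_nonneg: "i < n \<Longrightarrow> 0 \<le> enc i m as ss ks x"
  and enc_sum: "i < n \<Longrightarrow> (\<Sum>x\<in>UNIV. enc i m as ss ks x) = 1"
  using code by (auto simp: is_code_def)

lemma in_spaceD:
  assumes "w \<in> code_space i Mn Kf"
  shows "msg w \<in> {1..Mn}" "length (states w) = i" "length (inputs w) = i" "length (outputs w) = i"
    "length (eaves w) = i" "length (feedback w) = i" "\<And>j. j < i \<Longrightarrow> feedback w ! j \<in> Kf j"
  using assms by (auto simp: code_space_def component_defs)

lemma finite_space: "finite space"
proof -
  let ?L = "\<lambda>A. {xs. set xs \<subseteq> A \<and> length xs = n}"
  have "finite (\<Union>i<n. Kf i)" using Kf_finite by auto
  then have "finite ({1..Mn} \<times> ?L (UNIV :: 's set) \<times> ?L (UNIV :: 'x set) \<times> ?L (UNIV :: 'y set)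
      \<times> ?L (UNIV :: 'z set) \<times> ?L (\<Union>i<n. Kf i))"
    by (intro finite_cartesian_product finite_lists_length_eq) auto
  moreover have "space \<subseteq> {1..Mn} \<times> ?L (UNIV :: 's set) \<times> ?L (UNIV :: 'x set) \<times> ?L (UNIV :: 'y set)
      \<times> ?L (UNIV :: 'z set) \<times> ?L (\<Union>i<n. Kf i)"
    by (fastforce simp: code_space_def in_set_conv_nth)
  ultimately show ?thesis by (rule rev_finite_subset)
qed

lemma pmf_nonneg: "0 \<le> pmf w"
  by (auto simp: code_pmf_def ps_nonneg kf_nonneg enc_nonneg W_nonneg
      intro!: mult_nonneg_nonneg prod_nonneg divide_nonneg_nonneg split: prod.splits)

section \<open>One-step extensions and prefix probabilities\<close>

definition snoc ::
  "('s, 'x, 'y, 'z) outcome \<Rightarrow> nat \<times> 's \<times> 'x \<times> 'y \<times> 'z \<Rightarrow> ('s, 'x, 'y, 'z) outcome" where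
  "snoc v = (\<lambda>(k, s, x, y, z). (msg v, states v @ [s], inputs v @ [x], outputs v @ [y],
     eaves v @ [z], feedback v @ [k]))"

definition current :: "nat \<Rightarrow> ('s, 'x, 'y, 'z) outcome \<Rightarrow> nat \<times> 's \<times> 'x \<times> 'y \<times> 'z" where
  "current i w = (feedback w ! i, states w ! i, inputs w ! i, outputs w ! i, eaves w ! i)"

text \<open>The transition probability of one use, in causal order: feedback, state, input, outputs.
  The encoder's state and feedback lists already include the current symbols.\<close>

definition kernel :: "nat \<Rightarrow> ('s, 'x, 'y, 'z) outcome \<Rightarrow> nat \<times> 's \<times> 'x \<times> 'y \<times> 'z \<Rightarrow> real" where
  "kernel i v = (\<lambda>(k, s, x, y, z). kf i (outputs v) (feedback v) k * ps s
     * enc i (msg v) (inputs v) (states v @ [s]) (feedback v @ [k]) x * W x s y z)"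

text \<open>Causality: the factors with index below \<open>i\<close> read only the first
  \<open>i\<close> symbols, so appending a symbol multiplies by one new factor.\<close>

lemma code_pmf_snoc:
  assumes "v \<in> code_space i Mn Kf"
  shows "code_pmf ps W (Suc i) Mn kf enc (snoc v d) = code_pmf ps W i Mn kf enc v * kernel i v d"
proof -
  obtain m ss xs ys zs ks where v: "v = (m, ss, xs, ys, zs, ks)" by (cases v)
  obtain k s x y z where d: "d = (k, s, x, y, z)" by (cases d)
  have len: "length ss = i" "length xs = i" "length ys = i" "length zs = i" "length ks = i"
    using assms by (auto simp: v code_space_def)
  have "(\<Prod>j<i. ps ((ss @ [s]) ! j) * kf j (take j (ys @ [y])) (take j (ks @ [k])) ((ks @ [k]) ! j)
        * enc j m (take j (xs @ [x])) (take (Suc j) (ss @ [s])) (take (Suc j) (ks @ [k])) ((xs @ [x]) ! j)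
        * W ((xs @ [x]) ! j) ((ss @ [s]) ! j) ((ys @ [y]) ! j) ((zs @ [z]) ! j))
      = (\<Prod>j<i. ps (ss ! j) * kf j (take j ys) (take j ks) (ks ! j)
        * enc j m (take j xs) (take (Suc j) ss) (take (Suc j) ks) (xs ! j)
        * W (xs ! j) (ss ! j) (ys ! j) (zs ! j))"
    by (rule prod.cong) (auto simp: len nth_append)
  then show ?thesis
    by (simp add: v d snoc_def component_defs code_pmf_def kernel_def len nth_append mult_ac)
qed

lemma kernel_sum:
  assumes "i < n"
  shows "(\<Sum>d\<in>Kf i \<times> UNIV. kernel i v d) = 1"
proof -
  have U: "(UNIV :: ('s \<times> 'x \<times> 'y \<times> 'z) set) = UNIV \<times> UNIV \<times> UNIV \<times> UNIV" by simp
  show ?thesis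
    unfolding U sum.cartesian_product' kernel_def
    by (simp add: sum_distrib_left[symmetric] W_sum
        enc_sum[OF assms] ps_sum kf_sum[OF assms] mult.assoc)
qed

lemma snoc_in_space:
  assumes "v \<in> code_space i Mn Kf" "fst d \<in> Kf i"
  shows "snoc v d \<in> code_space (Suc i) Mn Kf"
  using assms by (cases v; cases d)
    (auto simp: snoc_def code_space_def component_defs nth_append less_Suc_eq)

lemma hist_Suc_eq_snoc_iff:
  assumes "w \<in> space" "i < n" "v \<in> code_space i Mn Kf"
  shows "hist (Suc i) w = snoc v d \<longleftrightarrow> hist i w = v \<and> current i w = d"
proof -
  obtain m ss xs ys zs ks where v: "v = (m, ss, xs, ys, zs, ks)" by (cases v)
  obtain k s x y z where d: "d = (k, s, x, y, z)" by (cases d)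
  have len: "length ss = i" "length xs = i" "length ys = i" "length zs = i" "length ks = i"
    using assms by (auto simp: v code_space_def)
  show ?thesis using in_spaceD[OF assms(1)] assms(2) len
    by (auto simp: v d hist_def snoc_def current_def take_Suc_eq_snoc_iff)
qed

text \<open>Downward induction from \<open>n\<close>: summing out the last use removes one kernel
  factor, whose total mass is 1.\<close>

lemma prob_hist:
  assumes "i \<le> n" "v \<in> code_space i Mn Kf"
  shows "prob_of space pmf (\<lambda>w. hist i w = v) = code_pmf ps W i Mn kf enc v"
  using assms
proof (induction arbitrary: v rule: inc_induct)
  case base
  have "{w \<in> space. hist n w = v} = {v}"
    using base by (auto simp: hist_def component_defs code_space_def)
  then show ?case by (simp add: prob_of_def)
next
  case (step i)
  have "prob_of space pmf (\<lambda>w. hist i w = v)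
      = (\<Sum>d\<in>Kf i \<times> UNIV. prob_of space pmf (\<lambda>w. hist i w = v \<and> current i w = d))"
    using step.hyps Kf_finite finite_space in_spaceD(7)[of _ n]
    by (intro prob_of_split) (auto simp: current_def)
  also have "\<dots> = (\<Sum>d\<in>Kf i \<times> UNIV. prob_of space pmf (\<lambda>w. hist (Suc i) w = snoc v d))"
    by (intro sum.cong refl prob_of_cong) (simp add: hist_Suc_eq_snoc_iff step.hyps step.prems)
  also have "\<dots> = (\<Sum>d\<in>Kf i \<times> UNIV. code_pmf ps W i Mn kf enc v * kernel i v d)"
    by (intro sum.cong refl)
       (auto simp: step.IH snoc_in_space step.prems code_pmf_snoc)
  also have "\<dots> = code_pmf ps W i Mn kf enc v"
    using kernel_sum[of i v] step.hyps by (simp add: sum_distrib_left[symmetric])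
  finally show ?case .
qed

lemma prob_msg:
  assumes "m \<in> {1..Mn}"
  shows "prob_of space pmf (\<lambda>w. msg w = m) = 1 / real Mn"
  using prob_hist[of 0 "(m, [], [], [], [], [])"] assms
  by (simp add: hist_def code_pmf_def code_space_def)

sublocale finite_prob space pmf
proof
  have "sum pmf space = prob_of space pmf (\<lambda>_. True)" by (simp add: prob_of_def)
  also have "\<dots> = (\<Sum>m\<in>{1..Mn}. prob_of space pmf (\<lambda>w. True \<and> msg w = m))"
    by (intro prob_of_split finite_space) (use in_spaceD(1) in simp_all)
  also have "\<dots> = 1" using Mn by (simp add: prob_msg)
  finally show "sum pmf space = 1" .
qed (auto simp: finite_space pmf_nonneg)

lemma ent_msg: "H msg = log 2 (real Mn)"
proof -
  have "H msg = - (\<Sum>w\<in>space. pmf w * log 2 (1 / real Mn))"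
    unfolding ent_alt by (intro arg_cong[where f=uminus] sum.cong refl)
      (simp only: prob_msg[OF in_spaceD(1)])
  then show ?thesis using Mn by (simp add: sum_negf sum_distrib_right[symmetric] P_total log_divide)
qed

text \<open>The ratio of consecutive prefix probabilities is the kernel. All conditional
  independence of the model is drawn from this identity.\<close>

lemma prob_hist_current:
  assumes "u \<in> space" "i < n" "k \<in> Kf i"
  shows "pr (\<lambda>w. hist i w = hist i u \<and> current i w = (k, d))
      = pr (\<lambda>w. hist i w = hist i u) * kernel i (hist i u) (k, d)"
proof -
  have h: "hist i u \<in> code_space i Mn Kf"
    using assms in_spaceD[OF assms(1)] by (auto simp: hist_def code_space_def)
  have "pr (\<lambda>w. hist i w = hist i u \<and> current i w = (k, d))
      = pr (\<lambda>w. hist (Suc i) w = snoc (hist i u) (k, d))"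
    by (intro prob_of_cong) (simp add: hist_Suc_eq_snoc_iff assms h)
  also have "\<dots> = code_pmf ps W i Mn kf enc (hist i u) * kernel i (hist i u) (k, d)"
    using assms h by (subst prob_hist) (auto simp: code_pmf_snoc snoc_in_space)
  finally show ?thesis using assms h by (simp add: prob_hist)
qed

section \<open>Conditional laws within one channel use\<close>

context
  fixes i :: nat
  assumes i: "i < n"
begin

abbreviation "Si \<equiv> \<lambda>w :: ('s, 'x, 'y, 'z) outcome. states w ! i"
abbreviation "Xi \<equiv> \<lambda>w :: ('s, 'x, 'y, 'z) outcome. inputs w ! i"
abbreviation "Yi \<equiv> \<lambda>w :: ('s, 'x, 'y, 'z) outcome. outputs w ! i"
abbreviation "Zi \<equiv> \<lambda>w :: ('s, 'x, 'y, 'z) outcome. eaves w ! i"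
abbreviation "Ki \<equiv> \<lambda>w :: ('s, 'x, 'y, 'z) outcome. feedback w ! i"

definition "kfw u k = kf i (take i (outputs u)) (take i (feedback u)) k"
  for u :: "('s, 'x, 'y, 'z) outcome" and k :: nat
definition "encw u k s x =
    enc i (msg u) (take i (inputs u)) (take i (states u) @ [s]) (take i (feedback u) @ [k]) x"
  for u :: "('s, 'x, 'y, 'z) outcome" and k :: nat and s x

text \<open>From here the current symbols are summed out in reverse causal order; each sum removes
  one normalised factor of the kernel.\<close>

lemma prob_KSXYZ:
  assumes "u \<in> space" "k \<in> Kf i"
  shows "pr (\<lambda>w. hist i w = hist i u \<and> Ki w = k \<and> Si w = s \<and> Xi w = x \<and> Yi w = y \<and> Zi w = z)
    = pr (\<lambda>w. hist i w = hist i u) * (kfw u k * ps s * encw u k s x * W x s y z)"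
  using prob_hist_current[OF assms(1) i assms(2), of "(s, x, y, z)"]
  by (simp add: current_def kernel_def kfw_def encw_def hist_def)

lemma prob_KSXZ:
  assumes "u \<in> space" "k \<in> Kf i"
  shows "pr (\<lambda>w. hist i w = hist i u \<and> Ki w = k \<and> Si w = s \<and> Xi w = x \<and> Zi w = z)
    = pr (\<lambda>w. hist i w = hist i u) * (kfw u k * ps s * encw u k s x * (\<Sum>y\<in>UNIV. W x s y z))"
  using prob_KSXYZ[OF assms, of s x _ z]
  by (subst pr_split[where f=Yi and J=UNIV]) (auto simp: sum_distrib_left conj_ac)

lemma prob_KSXY:
  assumes "u \<in> space" "k \<in> Kf i"
  shows "pr (\<lambda>w. hist i w = hist i u \<and> Ki w = k \<and> Si w = s \<and> Xi w = x \<and> Yi w = y)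
    = pr (\<lambda>w. hist i w = hist i u) * (kfw u k * ps s * encw u k s x * (\<Sum>z\<in>UNIV. W x s y z))"
  using prob_KSXYZ[OF assms, of s x y]
  by (subst pr_split[where f=Zi and J=UNIV]) (auto simp: sum_distrib_left conj_ac)

lemma prob_KSX:
  assumes "u \<in> space" "k \<in> Kf i"
  shows "pr (\<lambda>w. hist i w = hist i u \<and> Ki w = k \<and> Si w = s \<and> Xi w = x)
    = pr (\<lambda>w. hist i w = hist i u) * (kfw u k * ps s * encw u k s x)"
  using prob_KSXY[OF assms, of s x]
  by (subst pr_split[where f=Yi and J=UNIV]) (auto simp: sum_distrib_left[symmetric] conj_ac W_sum)

lemma prob_KS:
  assumes "u \<in> space" "k \<in> Kf i"
  shows "pr (\<lambda>w. hist i w = hist i u \<and> Ki w = k \<and> Si w = s)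
    = pr (\<lambda>w. hist i w = hist i u) * (kfw u k * ps s)"
  using prob_KSX[OF assms, of s]
  by (subst pr_split[where f=Xi and J=UNIV])
     (auto simp: sum_distrib_left[symmetric] conj_ac encw_def enc_sum[OF i])

lemma prob_K:
  assumes "u \<in> space" "k \<in> Kf i"
  shows "pr (\<lambda>w. hist i w = hist i u \<and> Ki w = k) = pr (\<lambda>w. hist i w = hist i u) * kfw u k"
  using prob_KS[OF assms]
  by (subst pr_split[where f=Si and J=UNIV]) (auto simp: sum_distrib_left[symmetric] conj_ac ps_sum)

lemma K_in: "u \<in> space \<Longrightarrow> Ki u \<in> Kf i"
  using in_spaceD(7) i by blast

text \<open>Here and in the next lemmas, \<open>T\<close> ranges between the whole past and the data
  that the law in question really reads. All such \<open>T\<close> give the same value, which is how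
  the Markov hypotheses of the one-step lemmas are met.\<close>

lemma cond_ent_K:
  assumes "determines (hist i) T" "determines T (\<lambda>w. (take i (outputs w), take i (feedback w)))"
  shows "cond_ent space pmf Ki T = - (\<Sum>w\<in>space. pmf w * log 2 (kfw w (Ki w)))"
proof (rule cond_ent_kernel[OF assms(1)])
  fix u w assume uw: "u \<in> space" "w \<in> space" "T u = T w"
  then have "kfw u = kfw w" using assms(2) unfolding determines_def kfw_def by (metis prod.inject)
  then show "pr (\<lambda>v. Ki v = Ki w \<and> hist i v = hist i u)
      = pr (\<lambda>v. hist i v = hist i u) * kfw w (Ki w)"
    using prob_K[OF uw(1) K_in[OF uw(2)]] by (simp add: conj_commute)
qed

lemma cond_ent_S:
  assumes "determines (\<lambda>w. (hist i w, Ki w)) T"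
  shows "cond_ent space pmf Si T = - (\<Sum>w\<in>space. pmf w * log 2 (ps (Si w)))"
proof (rule cond_ent_kernel[OF assms])
  fix u w assume uw: "u \<in> space"
  show "pr (\<lambda>v. Si v = Si w \<and> (hist i v, Ki v) = (hist i u, Ki u))
      = pr (\<lambda>v. (hist i v, Ki v) = (hist i u, Ki u)) * ps (Si w)"
    using prob_K[OF uw K_in[OF uw]] prob_KS[OF uw K_in[OF uw], of "Si w"] by (simp add: conj_ac)
qed

lemma cond_ent_SXZ:
  assumes "determines (\<lambda>w. (hist i w, Ki w)) T"
    "determines T (\<lambda>w. (Ki w, msg w, take i (states w), take i (inputs w), take i (feedback w)))"
  shows "cond_ent space pmf (\<lambda>w. (Si w, Xi w, Zi w)) T = - (\<Sum>w\<in>space. pmf w *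
      log 2 (ps (Si w) * encw w (Ki w) (Si w) (Xi w) * (\<Sum>y\<in>UNIV. W (Xi w) (Si w) y (Zi w))))"
proof (rule cond_ent_kernel[OF assms(1)])
  fix u w assume uw: "u \<in> space" "w \<in> space" "T u = T w"
  then have "(Ki u, msg u, take i (states u), take i (inputs u), take i (feedback u))
      = (Ki w, msg w, take i (states w), take i (inputs w), take i (feedback w))"
    using assms(2) unfolding determines_def by blast
  then have "encw u (Ki u) = encw w (Ki w)" by (auto simp: encw_def fun_eq_iff)
  then show "pr (\<lambda>v. (Si v, Xi v, Zi v) = (Si w, Xi w, Zi w) \<and> (hist i v, Ki v) = (hist i u, Ki u))
      = pr (\<lambda>v. (hist i v, Ki v) = (hist i u, Ki u)) *
        (ps (Si w) * encw w (Ki w) (Si w) (Xi w) * (\<Sum>y\<in>UNIV. W (Xi w) (Si w) y (Zi w)))"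
    using prob_K[OF uw(1) K_in[OF uw(1)]]
      prob_KSXZ[OF uw(1) K_in[OF uw(1)], of "Si w" "Xi w" "Zi w"]
    by (simp add: conj_ac)
qed

lemma cond_ent_Y_Z:
  assumes "determines (\<lambda>w. (hist i w, Ki w, Si w, Xi w, Zi w)) T"
    "determines T (\<lambda>w. (Xi w, Zi w, Si w))"
  shows "cond_ent space pmf Yi T = - (\<Sum>w\<in>space. pmf w *
      log 2 (W (Xi w) (Si w) (Yi w) (Zi w) / (\<Sum>y\<in>UNIV. W (Xi w) (Si w) y (Zi w))))"
proof (rule cond_ent_kernel[OF assms(1)])
  fix u w assume uw: "u \<in> space" "w \<in> space" "T u = T w"
  then have eq: "(Xi u, Zi u, Si u) = (Xi w, Zi w, Si w)"
    using assms(2) unfolding determines_def by blast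
  let ?s = "\<Sum>y\<in>UNIV. W (Xi w) (Si w) y (Zi w)"
  \<comment> \<open>The law of Y given the input, state and eavesdropper symbol is a quotient. Where
    its denominator is 0, the numerator is 0 too, so the convention 0/0 = 0 keeps the product
    formula true.\<close>
  have "W (Xi w) (Si w) (Yi w) (Zi w) = 0" if "?s = 0"
    using that W_nonneg by (subst (asm) sum_nonneg_eq_0_iff) auto
  then show "pr (\<lambda>v. Yi v = Yi w \<and>
        (hist i v, Ki v, Si v, Xi v, Zi v) = (hist i u, Ki u, Si u, Xi u, Zi u))
      = pr (\<lambda>v. (hist i v, Ki v, Si v, Xi v, Zi v) = (hist i u, Ki u, Si u, Xi u, Zi u)) *
        (W (Xi w) (Si w) (Yi w) (Zi w) / ?s)"
    using prob_KSXYZ[OF uw(1) K_in[OF uw(1)], of "Si w" "Xi w" "Yi w" "Zi w"]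
      prob_KSXZ[OF uw(1) K_in[OF uw(1)], of "Si w" "Xi w" "Zi w"] eq
    by (simp add: conj_ac)
qed

lemma cond_ent_Y:
  assumes "determines (\<lambda>w. (hist i w, Ki w, Si w, Xi w)) T" "determines T (\<lambda>w. (Xi w, Si w))"
  shows "cond_ent space pmf Yi T = - (\<Sum>w\<in>space. pmf w * log 2 (\<Sum>z\<in>UNIV. W (Xi w) (Si w) (Yi w) z))"
proof (rule cond_ent_kernel[OF assms(1)])
  fix u w assume uw: "u \<in> space" "w \<in> space" "T u = T w"
  then have eq: "(Xi u, Si u) = (Xi w, Si w)"
    using assms(2) unfolding determines_def by blast
  then show "pr (\<lambda>v. Yi v = Yi w \<and> (hist i v, Ki v, Si v, Xi v) = (hist i u, Ki u, Si u, Xi u))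
      = pr (\<lambda>v. (hist i v, Ki v, Si v, Xi v) = (hist i u, Ki u, Si u, Xi u)) *
        (\<Sum>z\<in>UNIV. W (Xi w) (Si w) (Yi w) z)"
    using prob_KSXY[OF uw(1) K_in[OF uw(1)], of "Si w" "Xi w" "Yi w"]
      prob_KSX[OF uw(1) K_in[OF uw(1)], of "Si w" "Xi w"]
    by (simp add: conj_ac)
qed

text \<open>These are H(S|Z) + I(X;Y|Z,S) and, below, I(X;Y|S) for use \<open>i\<close>. Mutual
  information is expanded on the side of Y because the subtracted term then involves the channel law
  only.\<close>

definition "leak_term = cond_ent space pmf Si Zi
  + (cond_ent space pmf Yi (\<lambda>w. (Zi w, Si w)) - cond_ent space pmf Yi (\<lambda>w. (Xi w, Zi w, Si w)))"

definition "rate_term = cond_ent space pmf Yi Si - cond_ent space pmf Yi (\<lambda>w. (Xi w, Si w))"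

end

section \<open>Views of the three parties and telescoped bounds\<close>

definition encoder_view :: "nat \<Rightarrow> ('s, 'x, 'y, 'z) outcome \<Rightarrow> _" where
  "encoder_view i w = (msg w, take i (states w), take i (inputs w), take i (feedback w))"

definition decoder_view :: "nat \<Rightarrow> ('s, 'x, 'y, 'z) outcome \<Rightarrow> _" where
  "decoder_view i w = (take i (outputs w), take i (states w), take i (feedback w))"

definition eaves_view :: "nat \<Rightarrow> ('s, 'x, 'y, 'z) outcome \<Rightarrow> _" where
  "eaves_view i w = take i (eaves w)"

lemmas view_defs = encoder_view_def decoder_view_def eaves_view_def

lemma take_Suc_space:
  assumes "v \<in> space" "w \<in> space" "i < n"
  shows "take (Suc i) (states v) = take (Suc i) (states w) \<longleftrightarrow>
      take i (states v) = take i (states w) \<and> states v ! i = states w ! i"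
    "take (Suc i) (inputs v) = take (Suc i) (inputs w) \<longleftrightarrow>
      take i (inputs v) = take i (inputs w) \<and> inputs v ! i = inputs w ! i"
    "take (Suc i) (outputs v) = take (Suc i) (outputs w) \<longleftrightarrow>
      take i (outputs v) = take i (outputs w) \<and> outputs v ! i = outputs w ! i"
    "take (Suc i) (eaves v) = take (Suc i) (eaves w) \<longleftrightarrow>
      take i (eaves v) = take i (eaves w) \<and> eaves v ! i = eaves w ! i"
    "take (Suc i) (feedback v) = take (Suc i) (feedback w) \<longleftrightarrow>
      take i (feedback v) = take i (feedback w) \<and> feedback v ! i = feedback w ! i"
  using in_spaceD(2-6)[OF assms(1)] in_spaceD(2-6)[OF assms(2)] assms(3)
  by (simp_all add: take_Suc_eq_iff)

lemma ent_K: "i < n \<Longrightarrow> H (\<lambda>w. feedback w ! i) \<le> log 2 (real (card (Kf i)))"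
  by (rule ent_le_log_card) (auto simp: Kf_finite K_in)

text \<open>Telescopes \<open>secret_information_step\<close>. Its hypotheses hold because feedback
  reads only the decoder's past, the state, input and eavesdropper symbol are produced from the
  encoder's past and the new feedback symbol, and Y depends only on the current use. The views at
  time 0 share no information, as the decoder's is empty.\<close>

lemma secret_information_bound:
  assumes "i \<le> n"
  shows "cond_mi space pmf (encoder_view i) (decoder_view i) (eaves_view i)
    \<le> (\<Sum>j<i. log 2 (real (card (Kf j))) + leak_term j)"
  using assms
proof (induction i)
  case 0
  have "cond_ent space pmf (encoder_view 0) (\<lambda>w. (decoder_view 0 w, eaves_view 0 w))
      = cond_ent space pmf (encoder_view 0) (eaves_view 0)"
    by (simp add: view_defs cond_ent_def)
  then show ?case by (simp add: cond_mi_def)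
next
  case (Suc i)
  then have i: "i < n" by simp
  let ?A = "encoder_view i" and ?B = "decoder_view i" and ?E = "eaves_view i"
  let ?K = "\<lambda>w. feedback w ! i" and ?S = "\<lambda>w. states w ! i" and ?X = "\<lambda>w. inputs w ! i"
    and ?Y = "\<lambda>w. outputs w ! i" and ?Z = "\<lambda>w. eaves w ! i"
  have "cond_mi space pmf (\<lambda>w. (?A w, ?K w, ?S w, ?X w)) (\<lambda>w. (?B w, ?K w, ?S w, ?Y w))
        (\<lambda>w. (?E w, ?Z w))
    \<le> cond_mi space pmf ?A ?B ?E + H ?K + cond_ent space pmf ?S ?Z
      + (cond_ent space pmf ?Y (\<lambda>w. (?Z w, ?S w)) - cond_ent space pmf ?Y (\<lambda>w. (?X w, ?Z w, ?S w)))"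
  proof (rule secret_information_step)
    show "cond_ent space pmf ?K (\<lambda>w. (?A w, ?B w, ?E w)) = cond_ent space pmf ?K (\<lambda>w. (?B w, ?E w))"
      by (subst (1 2) cond_ent_K[OF i]) (auto simp: determines_def view_defs hist_def)
    show "cond_ent space pmf (\<lambda>w. (?S w, ?X w, ?Z w)) (\<lambda>w. (?K w, ?A w, ?B w, ?E w))
        = cond_ent space pmf (\<lambda>w. (?S w, ?X w, ?Z w)) (\<lambda>w. (?K w, ?A w, ?E w))"
      by (subst (1 2) cond_ent_SXZ[OF i]) (auto simp: determines_def view_defs hist_def)
    show "cond_ent space pmf ?Y (\<lambda>w. (?K w, ?A w, ?B w, ?E w, ?S w, ?X w, ?Z w))
        = cond_ent space pmf ?Y (\<lambda>w. (?X w, ?Z w, ?S w))"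
      by (subst (1 2) cond_ent_Y_Z[OF i]) (auto simp: determines_def view_defs hist_def)
  qed
  moreover have "cond_mi space pmf (encoder_view (Suc i)) (decoder_view (Suc i))
        (eaves_view (Suc i))
      = cond_mi space pmf (\<lambda>w. (?A w, ?K w, ?S w, ?X w)) (\<lambda>w. (?B w, ?K w, ?S w, ?Y w))
        (\<lambda>w. (?E w, ?Z w))"
    using i by (intro cond_mi_cong) (auto simp: determines_def view_defs take_Suc_space)
  ultimately show ?case using Suc ent_K[OF i] by (simp add: leak_term_def[OF i])
qed

lemma information_bound:
  assumes "i \<le> n"
  shows "cond_mi space pmf msg (decoder_view i) (\<lambda>_. ()) \<le> (\<Sum>j<i. rate_term j)"
  using assms
proof (induction i)
  case 0
  have "cond_ent space pmf msg (\<lambda>w. (decoder_view 0 w, ())) = cond_ent space pmf msg (\<lambda>_. ())"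
    by (simp add: view_defs cond_ent_def)
  then show ?case by (simp add: cond_mi_def)
next
  case (Suc i)
  then have i: "i < n" by simp
  let ?C = "decoder_view i"
  let ?K = "\<lambda>w. feedback w ! i" and ?S = "\<lambda>w. states w ! i" and ?X = "\<lambda>w. inputs w ! i"
    and ?Y = "\<lambda>w. outputs w ! i"
  have "cond_mi space pmf msg (\<lambda>w. (?C w, ?K w, ?S w, ?Y w)) (\<lambda>_. ())
    \<le> cond_mi space pmf msg ?C (\<lambda>_. ())
      + (cond_ent space pmf ?Y ?S - cond_ent space pmf ?Y (\<lambda>w. (?X w, ?S w)))"
  proof (rule information_step)
    show "cond_ent space pmf ?K (\<lambda>w. (msg w, ?C w)) = cond_ent space pmf ?K ?C"
      by (subst (1 2) cond_ent_K[OF i]) (auto simp: determines_def view_defs hist_def)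
    show "cond_ent space pmf ?S (\<lambda>w. (?K w, msg w, ?C w)) = H ?S" unfolding ent_def
      by (subst (1 2) cond_ent_S[OF i]) (auto simp: determines_def view_defs hist_def)
    show "cond_ent space pmf ?Y (\<lambda>w. (?S w, ?K w, msg w, ?C w, ?X w))
        = cond_ent space pmf ?Y (\<lambda>w. (?X w, ?S w))"
      by (subst (1 2) cond_ent_Y[OF i]) (auto simp: determines_def view_defs hist_def)
  qed
  moreover have "cond_mi space pmf msg (decoder_view (Suc i)) (\<lambda>_. ())
      = cond_mi space pmf msg (\<lambda>w. (?C w, ?K w, ?S w, ?Y w)) (\<lambda>_. ())"
    using i by (intro cond_mi_cong) (auto simp: determines_def view_defs take_Suc_space)
  ultimately show ?case using Suc by (simp add: rate_term_def[OF i])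
qed

end

section \<open>Single-letter quantities\<close>

abbreviation "S1 \<equiv> \<lambda>(s, x, y, z). s"
abbreviation "X1 \<equiv> \<lambda>(s, x, y, z). x"
abbreviation "Y1 \<equiv> \<lambda>(s, x, y, z). y"
abbreviation "Z1 \<equiv> \<lambda>(s, x, y, z). z"

locale wiretap_channel =
  fixes ps :: "'s::finite \<Rightarrow> real"
    and W :: "'x::finite \<Rightarrow> 's \<Rightarrow> 'y::finite \<Rightarrow> 'z::finite \<Rightarrow> real"
  assumes ps: "is_pmf ps" and W: "valid_channel W"
begin

definition "leak1 q = cond_ent UNIV (single_pmf ps q W) S1 Z1
  + (cond_ent UNIV (single_pmf ps q W) Y1 (\<lambda>w. (Z1 w, S1 w))
    - cond_ent UNIV (single_pmf ps q W) Y1 (\<lambda>w. (X1 w, Z1 w, S1 w)))"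

definition "rate1 q = cond_ent UNIV (single_pmf ps q W) Y1 S1
  - cond_ent UNIV (single_pmf ps q W) Y1 (\<lambda>w. (X1 w, S1 w))"

lemma single_nonneg: "valid_cond q \<Longrightarrow> 0 \<le> single_pmf ps q W w"
  using ps W by
    (auto simp: single_pmf_def is_pmf_def valid_channel_def valid_cond_def split: prod.splits)

lemma finite_prob_single:
  assumes "valid_cond q"
  shows "finite_prob UNIV (single_pmf ps q W)"
proof
  have U: "(UNIV :: ('s \<times> 'x \<times> 'y \<times> 'z) set) = UNIV \<times> UNIV \<times> UNIV \<times> UNIV" by simp
  show "sum (single_pmf ps q W) UNIV = 1"
    using ps W assms
    unfolding U sum.cartesian_product' single_pmf_def is_pmf_def valid_channel_def valid_cond_def
    by (simp add: sum_distrib_left[symmetric])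
qed (auto simp: single_nonneg assms)

lemma bound_fun_eq:
  assumes "valid_cond q"
  shows "bound_fun ps W Rf q = min (leak1 q + Rf) (rate1 q)"
proof -
  interpret finite_prob UNIV "single_pmf ps q W" by (rule finite_prob_single[OF assms])
  show ?thesis by (simp add: bound_fun_def Let_def cond_mi_commute leak1_def rate1_def)
qed

text \<open>A bound uniform in \<open>q\<close>, which makes the supremum over input distributions a
  genuine real supremum.\<close>

lemma bound_fun_le:
  assumes "valid_cond q"
  shows "bound_fun ps W Rf q \<le> log 2 (real (card (UNIV :: 'y set)))"
proof -
  interpret finite_prob UNIV "single_pmf ps q W" by (rule finite_prob_single[OF assms])
  have "cond_ent UNIV (single_pmf ps q W) Y1 S1 \<le> log 2 (real (card (UNIV :: 'y set)))"
    by (rule order_trans[OF cond_ent_le_ent ent_le_log_card]) auto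
  then have "rate1 q \<le> log 2 (real (card (UNIV :: 'y set)))"
    using cond_ent_nonneg[of Y1 "\<lambda>w. (X1 w, S1 w)"] unfolding rate1_def by linarith
  then show ?thesis by (simp add: bound_fun_eq assms)
qed

text \<open>Given input, eavesdropper symbol and state, the law of the output is the normalised
  channel and does not involve \<open>q\<close>. The entropy is therefore linear in the joint law.
  The next lemma is the analogue without Z.\<close>

lemma single_cond_ent_XZS:
  assumes "valid_cond q"
  shows "cond_ent UNIV (single_pmf ps q W) Y1 (\<lambda>w. (X1 w, Z1 w, S1 w)) =
    - (\<Sum>w\<in>UNIV. single_pmf ps q W w *
        log 2 (case w of (s, x, y, z) \<Rightarrow> W x s y z / (\<Sum>y'\<in>UNIV. W x s y' z)))"
proof -
  interpret finite_prob UNIV "single_pmf ps q W" by (rule finite_prob_single[OF assms])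
  show ?thesis
  proof (rule cond_ent_kernel[where V="\<lambda>w. (X1 w, Z1 w, S1 w)"])
    fix u w :: "'s \<times> 'x \<times> 'y \<times> 'z"
    assume eq: "(X1 u, Z1 u, S1 u) = (X1 w, Z1 w, S1 w)"
    obtain s x y z where w: "w = (s, x, y, z)" by (cases w)
    have full: "pr (\<lambda>v. (X1 v, Z1 v, S1 v) = (x, z, s) \<and> Y1 v = y')
        = single_pmf ps q W (s, x, y', z)" for y'
    proof -
      have "{v. (X1 v, Z1 v, S1 v) = (x, z, s) \<and> Y1 v = y'} = {(s, x, y', z)}" by auto
      then show ?thesis by (simp add: prob_of_def)
    qed
    have marg: "pr (\<lambda>v. (X1 v, Z1 v, S1 v) = (x, z, s)) = ps s * q s x * (\<Sum>y'\<in>UNIV. W x s y' z)"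
      by (subst pr_split[where f=Y1 and J=UNIV])
         (simp_all only: full finite_UNIV, simp_all add: single_pmf_def sum_distrib_left)
    have "W x s y z = 0" if "(\<Sum>y'\<in>UNIV. W x s y' z) = 0"
      using that W by (subst (asm) sum_nonneg_eq_0_iff) (auto simp: valid_channel_def)
    then have "single_pmf ps q W (s, x, y, z)
        = ps s * q s x * (\<Sum>y'\<in>UNIV. W x s y' z) * (W x s y z / (\<Sum>y'\<in>UNIV. W x s y' z))"
      by (auto simp: single_pmf_def)
    then show "pr (\<lambda>v. Y1 v = Y1 w \<and> (X1 v, Z1 v, S1 v) = (X1 u, Z1 u, S1 u))
        = pr (\<lambda>v. (X1 v, Z1 v, S1 v) = (X1 u, Z1 u, S1 u)) *
          (case w of (s, x, y, z) \<Rightarrow> W x s y z / (\<Sum>y'\<in>UNIV. W x s y' z))"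
      unfolding eq by (simp only: w prod.case full marg conj_commute[of "_ = y"])
  qed (simp add: determines_def)
qed

lemma single_cond_ent_XS:
  assumes "valid_cond q"
  shows "cond_ent UNIV (single_pmf ps q W) Y1 (\<lambda>w. (X1 w, S1 w)) =
    - (\<Sum>w\<in>UNIV. single_pmf ps q W w * log 2 (case w of (s, x, y, z) \<Rightarrow> \<Sum>z'\<in>UNIV. W x s y z'))"
proof -
  interpret finite_prob UNIV "single_pmf ps q W" by (rule finite_prob_single[OF assms])
  show ?thesis
  proof (rule cond_ent_kernel[where V="\<lambda>w. (X1 w, S1 w)"])
    fix u w :: "'s \<times> 'x \<times> 'y \<times> 'z"
    assume eq: "(X1 u, S1 u) = (X1 w, S1 w)"
    obtain s x y z where w: "w = (s, x, y, z)" by (cases w)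
    have full: "pr (\<lambda>v. ((X1 v, S1 v) = (x, s) \<and> Y1 v = y') \<and> Z1 v = z')
        = single_pmf ps q W (s, x, y', z')" for y' z'
    proof -
      have "{v. ((X1 v, S1 v) = (x, s) \<and> Y1 v = y') \<and> Z1 v = z'} = {(s, x, y', z')}" by auto
      then show ?thesis by (simp add: prob_of_def)
    qed
    have y: "pr (\<lambda>v. (X1 v, S1 v) = (x, s) \<and> Y1 v = y')
        = ps s * q s x * (\<Sum>z'\<in>UNIV. W x s y' z')" for y'
      by (subst pr_split[where f=Z1 and J=UNIV])
         (simp_all only: full finite_UNIV, simp_all add: single_pmf_def sum_distrib_left)
    have marg: "pr (\<lambda>v. (X1 v, S1 v) = (x, s)) = ps s * q s x"
      using W by (subst pr_split[where f=Y1 and J=UNIV])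
         (simp_all only: y finite_UNIV, simp_all add: sum_distrib_left[symmetric] valid_channel_def)
    show "pr (\<lambda>v. Y1 v = Y1 w \<and> (X1 v, S1 v) = (X1 u, S1 u))
        = pr (\<lambda>v. (X1 v, S1 v) = (X1 u, S1 u)) * (case w of (s, x, y, z) \<Rightarrow> \<Sum>z'\<in>UNIV. W x s y z')"
      unfolding eq by (simp only: w prod.case y marg conj_commute[of "_ = y"])
  qed (simp add: determines_def)
qed

section \<open>Concavity in the input distribution\<close>

context
  fixes N :: nat and q :: "nat \<Rightarrow> 's \<Rightarrow> 'x \<Rightarrow> real" and qa :: "'s \<Rightarrow> 'x \<Rightarrow> real"
  assumes N: "0 < N" and q: "\<And>j. j < N \<Longrightarrow> valid_cond (q j)"
    and qa: "\<And>s x. qa s x = (\<Sum>j<N. q j s x) / real N"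
begin

lemma valid_cond_avg: "valid_cond qa"
proof -
  have "(\<Sum>x\<in>UNIV. qa s x) = (\<Sum>j<N. \<Sum>x\<in>UNIV. q j s x) / real N" for s
    by (simp add: qa sum_divide_distrib[symmetric] sum.swap[of _ UNIV])
  then show ?thesis using q N
    by (auto simp: valid_cond_def is_pmf_def qa intro!: divide_nonneg_nonneg sum_nonneg)
qed

lemma single_avg: "single_pmf ps qa W w = (\<Sum>j<N. single_pmf ps (q j) W w) / real N"
  by (cases w) (simp add: single_pmf_def qa sum_distrib_left sum_distrib_right sum_divide_distrib)

lemma single_concave:
  "(\<Sum>j<N. cond_ent UNIV (single_pmf ps (q j) W) X Y)
    \<le> real N * cond_ent UNIV (single_pmf ps qa W) X Y"
  by (rule cond_ent_concave) (auto simp: N single_avg q finite_prob_single)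

lemma single_linear:
  "(\<Sum>j<N. - (\<Sum>w\<in>UNIV. single_pmf ps (q j) W w * g w))
    = real N * - (\<Sum>w\<in>UNIV. single_pmf ps qa W w * g w)"
proof -
  have "real N * (\<Sum>w\<in>UNIV. single_pmf ps qa W w * g w)
      = (\<Sum>w\<in>UNIV. \<Sum>j<N. single_pmf ps (q j) W w * g w)"
    unfolding sum_distrib_left
  proof (rule sum.cong)
    show "real N * (single_pmf ps qa W w * g w) = (\<Sum>j<N. single_pmf ps (q j) W w * g w)" for w
      using N by (simp add: single_avg sum_distrib_right)
  qed simp
  then show ?thesis by (simp add: sum_negf sum.swap[of _ UNIV])
qed

text \<open>The two positive entropies are concave and the subtracted one is linear, so the
  difference is concave.\<close>

lemma leak1_concave: "(\<Sum>j<N. leak1 (q j)) \<le> real N * leak1 qa"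
proof -
  have "(\<Sum>j<N. cond_ent UNIV (single_pmf ps (q j) W) Y1 (\<lambda>w. (X1 w, Z1 w, S1 w)))
      = real N * cond_ent UNIV (single_pmf ps qa W) Y1 (\<lambda>w. (X1 w, Z1 w, S1 w))"
    by (simp add: single_cond_ent_XZS q valid_cond_avg single_linear del: mult_minus_right)
  then show ?thesis
    using single_concave[of S1 Z1] single_concave[of Y1 "\<lambda>w. (Z1 w, S1 w)"]
    unfolding leak1_def by (simp add: sum.distrib sum_subtractf distrib_left right_diff_distrib)
qed

lemma rate1_concave: "(\<Sum>j<N. rate1 (q j)) \<le> real N * rate1 qa"
proof -
  have "(\<Sum>j<N. cond_ent UNIV (single_pmf ps (q j) W) Y1 (\<lambda>w. (X1 w, S1 w)))
      = real N * cond_ent UNIV (single_pmf ps qa W) Y1 (\<lambda>w. (X1 w, S1 w))"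
    by (simp add: single_cond_ent_XS q valid_cond_avg single_linear del: mult_minus_right)
  then show ?thesis
    using single_concave[of Y1 S1]
    unfolding rate1_def by (simp add: sum_subtractf right_diff_distrib)
qed

end

end

section \<open>Single-letterization of the code bounds\<close>

context wiretap_code
begin

sublocale wiretap_channel ps W by unfold_locales (rule ps W)+

text \<open>The law of the input given the state at use \<open>i\<close>. At states of probability 0
  a point mass is the default, so that every row is a distribution; the joint law gives it weight
  0.\<close>

definition induced :: "nat \<Rightarrow> 's \<Rightarrow> 'x \<Rightarrow> real" where
  "induced i s x = (if ps s = 0 then of_bool (x = undefined)
     else pr (\<lambda>w. states w ! i = s \<and> inputs w ! i = x) / ps s)"

context
  fixes i :: nat
  assumes i: "i < n"
begin

text \<open>A factor \<open>c\<close> common to all histories survives averaging over them. This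
  turns history-wise identities into the laws of a single use.\<close>

lemma pr_over_hist:
  assumes "\<And>u. u \<in> space \<Longrightarrow>
      pr (\<lambda>w. hist i w = hist i u \<and> A w) = pr (\<lambda>w. hist i w = hist i u \<and> B w) * c"
  shows "pr A = pr B * c"
proof -
  have fin: "finite (hist i ` space)" using finite_space by simp
  have "pr A = (\<Sum>h\<in>hist i ` space. pr (\<lambda>w. A w \<and> hist i w = h))"
    using fin by (intro pr_split) auto
  also have "\<dots> = (\<Sum>h\<in>hist i ` space. pr (\<lambda>w. B w \<and> hist i w = h) * c)"
    by (intro sum.cong refl) (use assms in \<open>auto simp: conj_commute\<close>)
  also have "\<dots> = pr B * c"
    unfolding sum_distrib_right[symmetric] using fin
    by (subst (2) pr_split[of "hist i ` space" _ "hist i"]) auto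
  finally show ?thesis .
qed

lemma split_K:
  "pr (\<lambda>w. hist i w = hist i u \<and> A w)
    = (\<Sum>k\<in>Kf i. pr (\<lambda>w. hist i w = hist i u \<and> feedback w ! i = k \<and> A w))"
  using K_in[OF i] by (subst pr_split[where f="\<lambda>w. feedback w ! i" and J="Kf i"])
    (auto simp: Kf_finite[OF i] conj_ac)

lemma prob_S: "pr (\<lambda>w. states w ! i = s) = ps s"
proof -
  have "pr (\<lambda>w. states w ! i = s) = pr (\<lambda>_. True) * ps s"
    by (rule pr_over_hist)
      (simp add: split_K[where A="\<lambda>w. states w ! i = s"] prob_KS[OF i] sum_distrib_left[symmetric]
        sum_distrib_right[symmetric] kfw_def[OF i] kf_sum[OF i])
  then show ?thesis by (simp add: pr_True)
qed

lemma prob_SXYZ: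
  "pr (\<lambda>w. states w ! i = s \<and> inputs w ! i = x \<and> outputs w ! i = y \<and> eaves w ! i = z)
    = pr (\<lambda>w. states w ! i = s \<and> inputs w ! i = x) * W x s y z"
  by (rule pr_over_hist)
    (simp add: split_K[where A="\<lambda>w. states w ! i = s \<and> inputs w ! i = x
        \<and> outputs w ! i = y \<and> eaves w ! i = z"]
      split_K[where A="\<lambda>w. states w ! i = s \<and> inputs w ! i = x"]
      prob_KSX[OF i] prob_KSXYZ[OF i] sum_distrib_left sum_distrib_right mult_ac)

lemma prob_SX: "pr (\<lambda>w. states w ! i = s \<and> inputs w ! i = x) = ps s * induced i s x"
proof (cases "ps s = 0")
  case True
  have "pr (\<lambda>w. states w ! i = s \<and> inputs w ! i = x) \<le> pr (\<lambda>w. states w ! i = s)"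
    by (rule pr_mono) auto
  then show ?thesis
    using True pr_nonneg[of "\<lambda>w. states w ! i = s \<and> inputs w ! i = x"] by (simp add: prob_S)
qed (simp add: induced_def)

lemma valid_induced: "valid_cond (induced i)"
proof -
  have "(\<Sum>x\<in>UNIV. induced i s x) = 1" for s
  proof (cases "ps s = 0")
    case False
    have "pr (\<lambda>w. states w ! i = s) = (\<Sum>x\<in>UNIV. pr (\<lambda>w. states w ! i = s \<and> inputs w ! i = x))"
      by (rule pr_split) auto
    then show ?thesis using False
      by (simp add: induced_def prob_S sum_divide_distrib[symmetric])
  qed (simp add: induced_def of_bool_def)
  then show ?thesis
    by (auto simp: valid_cond_def is_pmf_def induced_def pr_nonneg ps_nonneg)
qed

text \<open>The state at use \<open>i\<close> has law \<open>ps\<close> and the channel is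
  memoryless, so the symbols of that use follow the single-letter law with input distribution
  \<open>induced i\<close>.\<close>

lemma cond_ent_single:
  "cond_ent UNIV (single_pmf ps (induced i) W) F G
    = cond_ent space pmf (\<lambda>w. F (states w ! i, inputs w ! i, outputs w ! i, eaves w ! i))
        (\<lambda>w. G (states w ! i, inputs w ! i, outputs w ! i, eaves w ! i))"
proof -
  have "single_pmf ps (induced i) W
      = (\<lambda>u. pr (\<lambda>w. (states w ! i, inputs w ! i, outputs w ! i, eaves w ! i) = u))"
    by (auto simp: fun_eq_iff single_pmf_def prob_SXYZ prob_SX)
  then show ?thesis by (simp add: cond_ent_pushforward)
qed

lemma leak_term_eq: "leak_term i = leak1 (induced i)"
  by (simp add: leak_term_def[OF i] leak1_def cond_ent_single)

lemma rate_term_eq: "rate_term i = rate1 (induced i)"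
  by (simp add: rate_term_def[OF i] rate1_def cond_ent_single)

end

lemma converse_bound:
  assumes n: "0 < n" and eps: "0 < \<epsilon>" "\<epsilon> < 1"
    and secret: "(1 - \<epsilon>) * H msg \<le> cond_ent space pmf msg eaves"
    and err: "pr (\<lambda>w. dec (outputs w) (states w) (feedback w) \<noteq> msg w) \<le> \<epsilon>"
  shows "\<exists>q. valid_cond q \<and>
    (1 - 2 * \<epsilon>) * log 2 (real Mn) + log 2 (1 - \<epsilon>) + \<epsilon> * log 2 \<epsilon>
      \<le> real n * bound_fun ps W Rf q"
proof -
  \<comment> \<open>The time average; the same \<open>q\<close> must serve both arguments of the
    minimum.\<close>
  define q where "q s x = (\<Sum>j<n. induced j s x) / real n" for s x
  note avg = n valid_induced q_def
  have vq: "valid_cond q" by (rule valid_cond_avg[OF avg])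
  have dn: "decoder_view n w = (outputs w, states w, feedback w)" if "w \<in> space" for w
    using in_spaceD[OF that] by (simp add: view_defs)
  define Fa where "Fa = - log 2 (1 - \<epsilon>) - \<epsilon> * log 2 \<epsilon> + \<epsilon> * log 2 (real Mn)"
  have F: "cond_ent space pmf msg (decoder_view n) \<le> Fa" unfolding Fa_def
  proof (rule fano[where g="\<lambda>(y, s, k). dec y s k"])
    have "pr (\<lambda>w. (\<lambda>(y, s, k). dec y s k) (decoder_view n w) \<noteq> msg w)
        = pr (\<lambda>w. dec (outputs w) (states w) (feedback w) \<noteq> msg w)"
      by (rule prob_of_cong) (simp add: dn)
    then show "pr (\<lambda>w. (\<lambda>(y, s, k). dec y s k) (decoder_view n w) \<noteq> msg w) \<le> \<epsilon>" using err by simp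
    show "msg w \<in> {1..Mn}" if "w \<in> space" for w using in_spaceD(1) that by blast
  qed (use eps Mn in auto)
  have "cond_mi space pmf msg (decoder_view n) (\<lambda>_. ()) \<le> (\<Sum>j<n. rate1 (induced j))"
    using information_bound[of n] by (simp add: rate_term_eq)
  also have "\<dots> \<le> real n * rate1 q" by (rule rate1_concave[OF avg])
  finally have "H msg - cond_ent space pmf msg (decoder_view n) \<le> real n * rate1 q"
    by (simp add: cond_mi_unit cond_ent_eq)
  then have rate: "log 2 (real Mn) - Fa \<le> real n * rate1 q" using F by (simp add: ent_msg)
  \<comment> \<open>The message is enlarged to the encoder's whole view, for which the telescoped
    bound is available.\<close>
  have "cond_mi space pmf msg (decoder_view n) (eaves_view n)
      \<le> cond_mi space pmf (encoder_view n) (decoder_view n) (eaves_view n)"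
    by (rule cond_mi_le) (simp add: determines_def view_defs)
  also have "\<dots> \<le> (\<Sum>j<n. log 2 (real (card (Kf j)))) + (\<Sum>j<n. leak1 (induced j))"
    using secret_information_bound[of n] by (simp add: leak_term_eq sum.distrib)
  also have "(\<Sum>j<n. log 2 (real (card (Kf j)))) \<le> real n * Rf"
    using code n by (simp add: is_code_def field_simps)
  also have "(\<Sum>j<n. leak1 (induced j)) \<le> real n * leak1 q" by (rule leak1_concave[OF avg])
  finally have "cond_mi space pmf msg (decoder_view n) (eaves_view n) \<le> real n * (leak1 q + Rf)"
    by (simp add: algebra_simps)
  \<comment> \<open>Fano's bound given the decoder's view persists when the eavesdropper's
    observation is added.\<close>
  moreover have "cond_ent space pmf msg (\<lambda>w. (decoder_view n w, eaves_view n w))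
      \<le> cond_ent space pmf msg (decoder_view n)"
    by (rule cond_ent_antimono) (simp add: determines_def)
  moreover have "cond_ent space pmf msg (eaves_view n) = cond_ent space pmf msg eaves"
  proof -
    have "eaves_view n w = eaves w" if "w \<in> space" for w
      using in_spaceD[OF that] by (simp add: view_defs)
    then have "H (eaves_view n) = H eaves"
      "H (\<lambda>w. (msg w, eaves_view n w)) = H (\<lambda>w. (msg w, eaves w))"
      by (auto intro!: ent_cong simp: determines_def)
    then show ?thesis by (simp add: cond_ent_eq)
  qed
  ultimately have leak: "(1 - \<epsilon>) * log 2 (real Mn) - Fa \<le> real n * (leak1 q + Rf)"
    using F secret by (simp add: cond_mi_def ent_msg)
  \<comment> \<open>The rate bound is weakened by this amount so that both bounds share one
    left-hand side. The factor \<open>1 - 2 * \<epsilon>\<close> thus loses one \<epsilon> to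
    secrecy and one to Fano.\<close>
  have "0 \<le> \<epsilon> * log 2 (real Mn)" using eps Mn by simp
  then have "(1 - \<epsilon>) * log 2 (real Mn) - Fa \<le> real n * min (leak1 q + Rf) (rate1 q)"
    using leak rate by (simp add: min_def algebra_simps)
  then have "(1 - 2 * \<epsilon>) * log 2 (real Mn) + log 2 (1 - \<epsilon>) + \<epsilon> * log 2 \<epsilon>
      \<le> real n * bound_fun ps W Rf q"
    by (simp add: Fa_def bound_fun_eq vq algebra_simps)
  then show ?thesis using vq by blast
qed

end

section \<open>Bounds uniform in the block length, and the limit\<close>

lemma achievable_bound:
  fixes W :: "'x::finite \<Rightarrow> 's::finite \<Rightarrow> 'y::finite \<Rightarrow> 'z::finite \<Rightarrow> real"
  assumes ps: "is_pmf ps" and W: "valid_channel W" and ach: "securely_achievable ps W Rf R"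
    and eps: "0 < \<epsilon>" "\<epsilon> < 1 / 2"
  shows "\<exists>q. valid_cond q \<and>
    (1 - 2 * \<epsilon>) * R + log 2 (1 - \<epsilon>) + \<epsilon> * log 2 \<epsilon> \<le> bound_fun ps W Rf q"
proof -
  obtain n Kf kf enc dec where n: "0 < n"
    and code: "is_code n (nat \<lceil>2 powr (real n * R)\<rceil>) Rf Kf kf enc dec"
    and sec: "cond_ent (code_space n (nat \<lceil>2 powr (real n * R)\<rceil>) Kf)
        (code_pmf ps W n (nat \<lceil>2 powr (real n * R)\<rceil>) kf enc) msg eaves
      / ent (code_space n (nat \<lceil>2 powr (real n * R)\<rceil>) Kf)
        (code_pmf ps W n (nat \<lceil>2 powr (real n * R)\<rceil>) kf enc) msg \<ge> 1 - \<epsilon>"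
    and err: "prob_of (code_space n (nat \<lceil>2 powr (real n * R)\<rceil>) Kf)
        (code_pmf ps W n (nat \<lceil>2 powr (real n * R)\<rceil>) kf enc)
        (\<lambda>(m, ss, xs, ys, zs, ks). dec ys ss ks \<noteq> m) \<le> \<epsilon>"
    using ach eps(1) unfolding securely_achievable_def Let_def msg_def eaves_def by blast
  define Mn where "Mn = nat \<lceil>2 powr (real n * R)\<rceil>"
  have Mn: "0 < Mn" by (simp add: Mn_def)
  interpret wiretap_code ps W n Mn Rf Kf kf enc dec
    using ps W Mn code by unfold_locales (simp_all add: Mn_def)
  have "2 powr (real n * R) \<le> real Mn" unfolding Mn_def by linarith
  then have MnR: "real n * R \<le> log 2 (real Mn)" using Mn by (simp add: le_log_iff)
  note sec = sec[folded Mn_def] and err = err[folded Mn_def]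
  \<comment> \<open>With a single message the secrecy ratio would be 0/0 = 0, below
    \<open>1 - \<epsilon>\<close>.\<close>
  have "H msg \<noteq> 0" using sec eps by auto
  moreover have "0 \<le> H msg" using Mn by (simp add: ent_msg)
  ultimately have "(1 - \<epsilon>) * H msg \<le> cond_ent space pmf msg eaves"
    using sec by (simp add: field_simps)
  moreover have "pr (\<lambda>w. dec (outputs w) (states w) (feedback w) \<noteq> msg w)
      = pr (\<lambda>(m, ss, xs, ys, zs, ks). dec ys ss ks \<noteq> m)"
    by (rule prob_of_cong) auto
  note ord_eq_le_trans[OF this err]
  ultimately obtain q where q: "valid_cond q"
    and le: "(1 - 2 * \<epsilon>) * log 2 (real Mn) + log 2 (1 - \<epsilon>) + \<epsilon> * log 2 \<epsilon>
      \<le> real n * bound_fun ps W Rf q"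
    using converse_bound[OF n eps(1)] eps by auto
  have "\<epsilon> * log 2 \<epsilon> \<le> 0" using eps by (intro mult_nonneg_nonpos) auto
  moreover have "log 2 (1 - \<epsilon>) \<le> 0" using eps by simp
  ultimately have "log 2 (1 - \<epsilon>) + \<epsilon> * log 2 \<epsilon> \<le> 0" by simp
  \<comment> \<open>The error terms are nonpositive and \<open>n\<close> is at least 1, so
    multiplying them by \<open>n\<close> only lowers the left-hand side. After division by
    \<open>n\<close> the bound holds with errors independent of \<open>n\<close>.\<close>
  then have "real n * (log 2 (1 - \<epsilon>) + \<epsilon> * log 2 \<epsilon>) \<le> 1 * (log 2 (1 - \<epsilon>) + \<epsilon> * log 2 \<epsilon>)"
    using n by (intro mult_right_mono_neg) auto
  moreover have "(1 - 2 * \<epsilon>) * (real n * R) \<le> (1 - 2 * \<epsilon>) * log 2 (real Mn)"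
    using MnR eps by (intro mult_left_mono) auto
  ultimately have "real n * ((1 - 2 * \<epsilon>) * R + log 2 (1 - \<epsilon>) + \<epsilon> * log 2 \<epsilon>)
      \<le> real n * bound_fun ps W Rf q"
    using le by (simp add: algebra_simps)
  then show ?thesis using q n by (intro exI[of _ q]) simp
qed

theorem theorem2:
  fixes ps :: "'s::finite \<Rightarrow> real"
    and W :: "'x::finite \<Rightarrow> 's \<Rightarrow> 'y::finite \<Rightarrow> 'z::finite \<Rightarrow> real"
    and Rf R :: real
  assumes "is_pmf ps" and "valid_channel W"
    and "securely_achievable ps W Rf R"
  shows "R \<le> (SUP q\<in>{q. valid_cond q}. bound_fun ps W Rf q)"
proof -
  interpret wiretap_channel ps W using assms by unfold_locales
  \<comment> \<open>The substitution of \<open>1 / t\<close> for \<epsilon> turns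
    \<open>\<epsilon> * log 2 \<epsilon>\<close> into \<open>- ln t / t / ln 2\<close>, which tends
    to 0 as \<open>t\<close> grows, so \<open>?f\<close> tends to \<open>R\<close>.\<close>
  let ?f = "\<lambda>t::real. (1 - 2 * (1 / t)) * R + log 2 (1 - 1 / t) + 1 / t * log 2 (1 / t)"
  have bdd: "bdd_above (bound_fun ps W Rf ` {q. valid_cond q})"
    by (rule bdd_aboveI2[where M="log 2 (real (card (UNIV :: 'y set)))"]) (simp add: bound_fun_le)
  have "?f t \<le> (SUP q\<in>{q. valid_cond q}. bound_fun ps W Rf q)" if "2 < t" for t
  proof -
    have "0 < 1 / t" "1 / t < 1 / 2" using that by (auto simp: field_simps)
    then obtain q where "valid_cond q" "?f t \<le> bound_fun ps W Rf q"
      using achievable_bound[OF assms] by blast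
    then show ?thesis using cSUP_upper[OF _ bdd, of q] by simp
  qed
  then have ev: "eventually (\<lambda>t. ?f t \<le> (SUP q\<in>{q. valid_cond q}. bound_fun ps W Rf q)) at_top"
    by (auto intro: eventually_mono[OF eventually_gt_at_top[of 2]])
  have inv: "((\<lambda>t::real. 1 / t) \<longlongrightarrow> 0) at_top"
    using tendsto_inverse_0_at_top[OF filterlim_ident] by (simp add: inverse_eq_divide)
  have "((\<lambda>t::real. (1 - 2 * (1 / t)) * R + log 2 (1 - 1 / t) - ln t / t / ln 2)
      \<longlongrightarrow> (1 - 2 * 0) * R + log 2 (1 - 0) - 0 / ln 2) at_top"
    by (intro tendsto_intros inv ln_x_over_x_tendsto_0) auto
  then have "((\<lambda>t::real. (1 - 2 * (1 / t)) * R + log 2 (1 - 1 / t) - ln t / t / ln 2) \<longlongrightarrow> R) at_top"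
    by simp
  moreover have "eventually (\<lambda>t. (1 - 2 * (1 / t)) * R + log 2 (1 - 1 / t) - ln t / t / ln 2
      = ?f t) at_top"
    by (rule eventually_mono[OF eventually_gt_at_top[of 0]]) (simp add: log_def ln_div)
  ultimately have "(?f \<longlongrightarrow> R) at_top"
    by (rule Lim_transform_eventually)
  then show ?thesis by (rule tendsto_upperbound[OF _ ev]) simp
qed

end
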